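(* Let $n\ge1$ and $\theta>1$, and let $P_\theta$ be the $n!\times n!$ transition matrix indexed by $S_n$ whose entry for the transition from $\sigma$ to $\tau$ is $\theta^{\gamma(\tau\sigma^{-1})}/\theta^{(n)}$. Then the eigenvalues of $P_\theta$, with their multiplicities, are $$\beta_{\lambda,\theta}=\prod_{i=1}^{n}\frac{\theta+c_\lambda(i)}{\theta+i-1}\quad\text{with multiplicity } d_\lambda^2,\qquad \lambda\vdash n$$ (the multiplicities being added up whenever values for different $\lambda$ coincide).
   Context: $\gamma(\sigma)$ is the number of cycles of $\sigma\in S_n$ (fixed points included), and $\theta^{(n)}=\theta(\theta+1)\cdots(\theta+n-1)$. For a partition $\lambda\vdash n$, $d_\lambda$ is the number of standard Young tableaux of shape $\lambda$, equivalently the dimension of the irreducible representation of $S_n$ indexed by $\lambda$. The content of a box of the Young diagram of $\lambda$ is its column number minus its row number. $c_\lambda(i)$ is the content of the $i$-th box of $\lambda$ when the boxes are numbered $1,\dots,n$ row by row, left to right in each row, starting with the first (longest) row. *)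

theory Defs
  imports "Jordan_Normal_Form.Char_Poly" "HOL-Combinatorics.Permutations"
    "HOL-Combinatorics.Orbits" Complex_Main
begin

definition cycle_count :: "nat \<Rightarrow> (nat \<Rightarrow> nat) \<Rightarrow> nat" where
  "cycle_count n \<sigma> = card (orbit \<sigma> ` {1..n})"

definition partitions :: "nat \<Rightarrow> nat list set" where
  "partitions n = {l. sorted_wrt (\<ge>) l \<and> 0 \<notin> set l \<and> sum_list l = n}"

(* Boxes are (row, column) pairs, numbered from 0; contents are not affected by the shift. *)
definition young_diagram :: "nat list \<Rightarrow> (nat \<times> nat) set" where
  "young_diagram l = {(r, c). r < length l \<and> c < l ! r}"

definition standard_tableaux :: "nat list \<Rightarrow> (nat \<times> nat \<Rightarrow> nat) set" where
  "standard_tableaux l =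
    {T \<in> extensional (young_diagram l).
       bij_betw T (young_diagram l) {1..sum_list l} \<and>
       (\<forall>r c c'. (r, c) \<in> young_diagram l \<longrightarrow> (r, c') \<in> young_diagram l \<longrightarrow> c < c' \<longrightarrow>
          T (r, c) < T (r, c')) \<and>
       (\<forall>r r' c. (r, c) \<in> young_diagram l \<longrightarrow> (r', c) \<in> young_diagram l \<longrightarrow> r < r' \<longrightarrow>
          T (r, c) < T (r', c))}"

definition tableaux_count :: "nat list \<Rightarrow> nat" where
  "tableaux_count l = card (standard_tableaux l)"

definition content_of :: "nat \<times> nat \<Rightarrow> int" where
  "content_of b = int (snd b) - int (fst b)"

definition boxes_by_row :: "nat list \<Rightarrow> (nat \<times> nat) list" where
  "boxes_by_row l = concat (map (\<lambda>r. map (\<lambda>c. (r, c)) [0..<l ! r]) [0..<length l])"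

(* The boxes are numbered from 1, list positions from 0. *)
definition box_content :: "nat list \<Rightarrow> nat \<Rightarrow> int" where
  "box_content l i = content_of (boxes_by_row l ! (i - 1))"

definition \<beta> :: "nat \<Rightarrow> real \<Rightarrow> nat list \<Rightarrow> real" where
  "\<beta> n \<theta> l = (\<Prod>i = 1..n. (\<theta> + real_of_int (box_content l i)) / (\<theta> + real i - 1))"

(* Matrices are indexed by initial segments of the naturals, so S_n has to be enumerated by some e.
   Rows are the states left, columns the states entered. *)
definition transition_matrix :: "nat \<Rightarrow> real \<Rightarrow> (nat \<Rightarrow> nat \<Rightarrow> nat) \<Rightarrow> real mat" where
  "transition_matrix n \<theta> e =
    mat (fact n) (fact n)
      (\<lambda>(i, j). \<theta> ^ cycle_count n (e j \<circ> inv_into UNIV (e i)) / pochhammer \<theta> n)"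

end

theory Submission imports Defs begin

text \<open>On functions on \<open>S\<^sub>n\<close>, the matrix acts as the product of the operators
  \<open>(\<theta> + J\<^sub>k) / (\<theta> + k - 1)\<close>, where \<open>J\<^sub>k\<close> is left translation by the \<open>k\<close>-th Jucys-Murphy element.
  So it suffices to find a basis of joint eigenvectors of the \<open>J\<^sub>k\<close>. For each \<open>\<lambda>\<close> the Specht polynomial
  of the column reading tableau, evaluated at the values of a permutation, is a joint eigenvector for
  right translation whose eigenvalues are the contents (by Lagrange interpolation, a form of the Garnir
  relations). Its correlation with itself is a nonzero joint eigenvector for both translations. The
  moves \<open>v \<mapsto> s\<^sub>k v - v / (c\<^sub>k\<^sub>+\<^sub>1 - c\<^sub>k)\<close> of Young's seminormal form connect all standard tableaux of shape
  \<open>\<lambda>\<close>, on the left and on the right independently, so that every pair of standard tableaux of the same shape yields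
  a nonzero two-sided joint eigenvector. These are linearly independent, as contents determine
  a tableau, and there are \<open>n!\<close> of them because the squares of the \<open>d\<^sub>\<lambda>\<close> add up to \<open>n!\<close>.\<close>

section \<open>Order ideals and growth words\<close>

text \<open>No irreducible representation is constructed and the group algebra is never decomposed;
  both are replaced by a count, which is why each tableau enters in a pair. The Jucys-Murphy
  elements acting from the left are too coarse by themselves: a tableau of shape lambda belongs to a
  joint eigenspace of dimension d_lambda. Those acting from the right cut it into lines. As the two
  translations commute, a move on one side does not disturb the eigenvalues on the other. The
  exponent 2 in the multiplicity is thus the number of sides, and completeness rests on the identity
  for n!, which is proved by counting edges of Young's lattice. The divisor in the seminormal move
  is the only one that works: it has to absorb the 1 in s_k J_k = J_{k+1} s_k - 1. It never loses a
  vector, because neighbouring entries that may be exchanged have contents at least 2 apart. Young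
  diagrams appear as finite order ideals of pairs of naturals. As sets they are closed under union
  and intersection, and adding or removing a box needs no bookkeeping of row lengths.\<close>

definition order_ideal :: "(nat \<times> nat) set \<Rightarrow> bool" where
  "order_ideal D \<longleftrightarrow> (\<forall>r c r' c'. (r, c) \<in> D \<longrightarrow> r' \<le> r \<longrightarrow> c' \<le> c \<longrightarrow> (r', c') \<in> D)"

lemma order_idealD: "order_ideal D \<Longrightarrow> (r, c) \<in> D \<Longrightarrow> r' \<le> r \<Longrightarrow> c' \<le> c \<Longrightarrow> (r', c') \<in> D"
  unfolding order_ideal_def by blast

lemma order_ideal_empty: "order_ideal {}"
  unfolding order_ideal_def by blast

lemma order_ideal_Un: "order_ideal D \<Longrightarrow> order_ideal E \<Longrightarrow> order_ideal (D \<union> E)"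
  unfolding order_ideal_def by blast

lemma order_ideal_Int: "order_ideal D \<Longrightarrow> order_ideal E \<Longrightarrow> order_ideal (D \<inter> E)"
  unfolding order_ideal_def by blast

lemma finite_down_closed_nat:
  fixes S :: "nat set"
  assumes "finite S" "\<And>x y. x \<in> S \<Longrightarrow> y \<le> x \<Longrightarrow> y \<in> S"
  obtains k where "S = {..<k}"
proof -
  obtain m where m: "m \<notin> S" using ex_new_if_finite[OF infinite_UNIV_nat assms(1)] by blast
  define k where "k = (LEAST k. k \<notin> S)"
  have "k \<notin> S" unfolding k_def using m by (rule LeastI)
  moreover have "y \<in> S" if "y < k" for y using not_less_Least[of y "\<lambda>k. k \<notin> S"] that unfolding k_def by blast
  ultimately have "S = {..<k}" using assms(2) by (auto simp: not_less[symmetric])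
  then show ?thesis by (rule that)
qed

lemma order_ideal_rows:
  assumes "finite D" "order_ideal D"
  obtains len where "\<And>r c. (r, c) \<in> D \<longleftrightarrow> c < len r" "\<And>r r'. r \<le> r' \<Longrightarrow> len r' \<le> len r"
proof -
  have "\<exists>k. \<forall>c. (r, c) \<in> D \<longleftrightarrow> c < k" for r
  proof -
    have "{c. (r, c) \<in> D} \<subseteq> snd ` D" by force
    then have "finite {c. (r, c) \<in> D}" using assms(1) finite_subset by blast
    then obtain k where "{c. (r, c) \<in> D} = {..<k}"
      by (rule finite_down_closed_nat) (use order_idealD[OF assms(2)] in blast)
    then show ?thesis by (intro exI[of _ k]) auto
  qed
  then obtain len where row: "\<And>r c. (r, c) \<in> D \<longleftrightarrow> c < len r" by metis
  have "len r' \<le> len r" if "r \<le> r'" for r r'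
    using order_idealD[OF assms(2), of r' "len r" r "len r"] row that by (meson leI le_refl less_irrefl)
  then show ?thesis using row that by blast
qed

text \<open>A growth word lists the boxes of a standard tableau in the order of their entries.\<close>

inductive growth :: "(nat \<times> nat) list \<Rightarrow> bool" where
  growth_Nil: "growth []"
| growth_snoc: "growth xs \<Longrightarrow> b \<notin> set xs \<Longrightarrow> order_ideal (insert b (set xs)) \<Longrightarrow> growth (xs @ [b])"

lemma growth_snoc_iff:
  "growth (xs @ [b]) \<longleftrightarrow> growth xs \<and> b \<notin> set xs \<and> order_ideal (insert b (set xs))"
  by (subst growth.simps) auto

lemma growth_distinct: "growth xs \<Longrightarrow> distinct xs"
  by (induction rule: growth.induct) auto

lemma growth_order_ideal: "growth xs \<Longrightarrow> order_ideal (set xs)"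
  by (induction rule: growth.induct) (auto simp: order_ideal_empty)

lemma growth_prefix: "growth (xs @ ys) \<Longrightarrow> growth xs"
proof (induction ys rule: rev_induct)
  case (snoc y ys)
  then have "growth ((xs @ ys) @ [y])" by simp
  then show ?case using snoc.IH growth_snoc_iff by blast
qed simp

lemma length_growth: "growth xs \<Longrightarrow> length xs = card (set xs)"
  using distinct_card growth_distinct by fastforce

definition column_less :: "nat \<times> nat \<Rightarrow> nat \<times> nat \<Rightarrow> bool" where
  "column_less a b \<longleftrightarrow> snd a < snd b \<or> (snd a = snd b \<and> fst a < fst b)"

text \<open>The bottom box of the rightmost column is last in the column order. No box lies below it
  or to its right, so removing it leaves an order ideal, and recursion produces the column reading
  tableau.\<close>

lemma column_growth_exists:
  assumes "finite D" "order_ideal D"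
  shows "\<exists>xs. growth xs \<and> set xs = D \<and> sorted_wrt column_less xs"
  using assms
proof (induction "card D" arbitrary: D)
  case 0
  then show ?case by (intro exI[of _ "[]"]) (auto intro: growth_Nil)
next
  case (Suc m)
  then have "D \<noteq> {}" by auto
  define c where "c = Max (snd ` D)"
  have c: "c \<in> snd ` D" "\<And>b. b \<in> D \<Longrightarrow> snd b \<le> c"
    using Suc.prems(1) \<open>D \<noteq> {}\<close> unfolding c_def by auto
  define R where "R = {r. (r, c) \<in> D}"
  have "R \<subseteq> fst ` D" unfolding R_def by force
  then have R: "finite R" "R \<noteq> {}" using Suc.prems(1) c(1) finite_subset
    unfolding R_def by (blast, force)
  define r where "r = Max R"
  have r: "r \<in> R" "\<And>x. x \<in> R \<Longrightarrow> x \<le> r" using R unfolding r_def by auto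
  define b where "b = (r, c)"
  have b: "b \<in> D" using r(1) unfolding b_def R_def by simp
  have less: "column_less a b" if "a \<in> D" "a \<noteq> b" for a
  proof (cases "snd a = c")
    case True
    then have "fst a \<in> R" using that unfolding R_def by auto
    moreover have "fst a \<noteq> r" using that True unfolding b_def by (cases a) auto
    ultimately have "fst a < r" using r(2) by fastforce
    then show ?thesis using True unfolding column_less_def b_def by simp
  next
    case False
    then show ?thesis using c(2)[OF that(1)] unfolding column_less_def b_def by simp
  qed
  have "order_ideal (D - {b})" unfolding order_ideal_def
  proof (intro allI impI)
    fix x y x' y' assume a: "(x, y) \<in> D - {b}" "x' \<le> x" "y' \<le> y"
    have "(x', y') \<noteq> b"
      using less[of "(x, y)"] a unfolding column_less_def b_def by auto
    then show "(x', y') \<in> D - {b}" using a Suc.prems(2) order_idealD by blast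
  qed
  moreover have "card (D - {b}) = m" using b Suc.hyps(2) Suc.prems(1) by simp
  ultimately obtain xs where xs: "growth xs" "set xs = D - {b}" "sorted_wrt column_less xs"
    using Suc.hyps(1)[of "D - {b}"] Suc.prems(1) by auto
  have "growth (xs @ [b])"
    using xs b Suc.prems(2) by (auto simp: growth_snoc_iff insert_absorb)
  moreover have "set (xs @ [b]) = D" using xs b by auto
  moreover have "sorted_wrt column_less (xs @ [b])" using xs less by (auto simp: sorted_wrt_append)
  ultimately show ?case by blast
qed

lemma growth_exists:
  assumes "finite D" "order_ideal D"
  shows "\<exists>xs. growth xs \<and> set xs = D"
  using column_growth_exists[OF assms] by blast

text \<open>Two different addable boxes are incomparable, so one lies strictly above and strictly to
  the right of the other; each coordinate then adds at least 1 to the difference. The bound serves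
  twice: equal contents force equal boxes, and differences 1 and -1 are excluded when neighbours are
  exchanged.\<close>

lemma content_addable:
  assumes "order_ideal (insert a D)" "order_ideal (insert b D)" "a \<notin> D" "b \<notin> D" "a \<noteq> b"
  shows "\<bar>content_of b - content_of a\<bar> \<ge> 2"
proof -
  obtain r c r' c' where ab: "a = (r, c)" "b = (r', c')" by (cases a, cases b) auto
  have "\<not> (r \<le> r' \<and> c \<le> c')" "\<not> (r' \<le> r \<and> c' \<le> c)"
    using order_idealD[OF assms(2), of r' c' r c] order_idealD[OF assms(1), of r c r' c'] assms(3-) ab
    by auto
  then show ?thesis unfolding content_of_def ab by auto
qed

text \<open>Once the shorter words agree, both last boxes are addable to the same ideal, where the
  content identifies the box. This is what separates the joint eigenvalues of different
  tableaux.\<close>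

lemma growth_eq_contents:
  assumes "growth xs" "growth ys" "map content_of xs = map content_of ys"
  shows "xs = ys"
  using assms
proof (induction xs arbitrary: ys rule: rev_induct)
  case (snoc a xs)
  then obtain ys' b where ys: "ys = ys' @ [b]" by (cases ys rule: rev_cases) auto
  have eq: "xs = ys'" using snoc ys by (auto simp: growth_snoc_iff)
  have "content_of a = content_of b" using snoc.prems ys by auto
  then have "a = b" using content_addable[of a "set xs" b] snoc.prems ys eq
    by (auto simp: growth_snoc_iff)
  then show ?case using eq ys by simp
qed simp

section \<open>Exchanging neighbouring entries of a tableau\<close>

definition growth_step :: "(nat \<times> nat) list \<Rightarrow> (nat \<times> nat) list \<Rightarrow> bool" where
  "growth_step xs ys \<longleftrightarrow> growth xs \<and> growth ys \<and>
     (\<exists>us a b vs. xs = us @ [a, b] @ vs \<and> ys = us @ [b, a] @ vs)"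

lemma growth_step_snoc:
  assumes "growth_step xs ys" "growth (xs @ [b])"
  shows "growth_step (xs @ [b]) (ys @ [b])"
proof -
  obtain us a c vs where xy: "growth xs" "growth ys" "xs = us @ [a, c] @ vs" "ys = us @ [c, a] @ vs"
    using assms(1) unfolding growth_step_def by blast
  have "set xs = set ys" using xy by auto
  then have "growth (ys @ [b])" using assms(2) xy(2) growth_snoc_iff by metis
  then show ?thesis unfolding growth_step_def using xy assms(2)
    by (metis append.assoc)
qed

lemma growth_steps_snoc:
  assumes "growth_step\<^sup>*\<^sup>* xs ys" "growth (xs @ [b])"
  shows "growth_step\<^sup>*\<^sup>* (xs @ [b]) (ys @ [b]) \<and> growth (ys @ [b])"
  using assms
proof (induction rule: rtranclp_induct)
  case (step y z)
  then have "growth_step (y @ [b]) (z @ [b])" using growth_step_snoc by blast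
  then show ?case using step by (meson growth_step_def rtranclp.rtrancl_into_rtrancl)
qed simp

text \<open>If the last boxes \<open>a\<close> and \<open>b\<close> differ, both are removable, so
  any growth of the remaining ideal \<open>E\<close> can be completed by them in either order. The
  two completions differ by one exchange, and induction joins each of them to the given word with
  the same last box.\<close>

lemma growth_connected:
  assumes "growth xs" "growth ys" "set xs = set ys"
  shows "growth_step\<^sup>*\<^sup>* xs ys"
  using assms
proof (induction "length xs" arbitrary: xs ys)
  case 0
  then show ?case by auto
next
  case (Suc m)
  then obtain xs' a where xs: "xs = xs' @ [a]" by (cases xs rule: rev_cases) auto
  from Suc xs obtain ys' b where ys: "ys = ys' @ [b]" by (cases ys rule: rev_cases) auto
  have gx: "growth xs'" "a \<notin> set xs'" and gy: "growth ys'" "b \<notin> set ys'"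
    using Suc.prems xs ys by (auto simp: growth_snoc_iff)
  have sets: "insert a (set xs') = insert b (set ys')" using Suc.prems(3) xs ys by simp
  have m: "m = length xs'" using Suc.hyps(2) xs by simp
  have lens: "length xs' = length ys'"
    using length_growth[OF Suc.prems(1)] length_growth[OF Suc.prems(2)] Suc.prems(3) xs ys by simp
  show ?case
  proof (cases "a = b")
    case True
    then have "set xs' = set ys'" using sets gx gy by auto
    then have "growth_step\<^sup>*\<^sup>* xs' ys'" using Suc.hyps(1)[OF m] gx gy by blast
    then show ?thesis using growth_steps_snoc Suc.prems(1) xs ys True by blast
  next
    case False
    define E where "E = set xs' \<inter> set ys'"
    have "order_ideal E" "finite E"
      unfolding E_def using gx gy growth_order_ideal order_ideal_Int by auto
    then obtain zs where zs: "growth zs" "set zs = E" using growth_exists by blast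
    have ea: "set ys' = insert a E" "a \<notin> E" and eb: "set xs' = insert b E" "b \<notin> E"
      using sets False gx gy unfolding E_def by auto
    have ga: "growth (zs @ [a])" "growth (zs @ [b])"
      using zs ea eb growth_order_ideal[OF gx(1)] growth_order_ideal[OF gy(1)] by (auto simp: growth_snoc_iff)
    have gxs: "insert a (insert b E) = set xs" using xs eb by auto
    have gab: "growth ((zs @ [b]) @ [a])" "growth ((zs @ [a]) @ [b])"
      using ga zs ea eb False growth_order_ideal[OF Suc.prems(1)] gxs
      unfolding growth_snoc_iff by (auto simp: insert_commute)
    have "growth_step\<^sup>*\<^sup>* xs' (zs @ [b])" using Suc.hyps(1)[OF m gx(1) ga(2)] zs eb by simp
    then have 1: "growth_step\<^sup>*\<^sup>* xs ((zs @ [b]) @ [a])" using growth_steps_snoc Suc.prems(1) xs by blast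
    have 2: "growth_step ((zs @ [b]) @ [a]) ((zs @ [a]) @ [b])"
      unfolding growth_step_def using gab by (metis append.assoc append_Cons append_Nil append_Nil2)
    have "growth_step\<^sup>*\<^sup>* (zs @ [a]) ys'"
      using Suc.hyps(1)[OF _ ga(1) gy(1)] zs ea m lens
        length_growth[OF ga(1)] length_growth[OF gy(1)] by simp
    then have 3: "growth_step\<^sup>*\<^sup>* ((zs @ [a]) @ [b]) ys" using growth_steps_snoc gab ys by blast
    from 1 2 3 show ?thesis by (meson rtranclp.rtrancl_into_rtrancl rtranclp_trans)
  qed
qed

section \<open>Counting pairs of tableaux\<close>

definition addable :: "(nat \<times> nat) set \<Rightarrow> (nat \<times> nat) set" where
  "addable D = {b. b \<notin> D \<and> order_ideal (insert b D)}"

definition removable :: "(nat \<times> nat) set \<Rightarrow> (nat \<times> nat) set" where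
  "removable D = {b \<in> D. order_ideal (D - {b})}"

definition ideals :: "nat \<Rightarrow> (nat \<times> nat) set set" where
  "ideals n = {D. finite D \<and> order_ideal D \<and> card D = n}"

definition growth_count :: "(nat \<times> nat) set \<Rightarrow> nat" where
  "growth_count D = card {xs. growth xs \<and> set xs = D}"

lemma finite_growths: "finite D \<Longrightarrow> finite {xs. growth xs \<and> set xs = D}"
  by (rule finite_subset[OF _ finite_lists_length_eq[of D "card D"]])
     (auto simp: length_growth)

text \<open>A box brings along all boxes above it and all boxes to its left, so both of its
  coordinates are bounded by the number of boxes.\<close>

lemma finite_ideals: "finite (ideals n)"
proof (rule finite_subset)
  show "ideals n \<subseteq> Pow ({..n} \<times> {..n})"
  proof
    fix D assume D: "D \<in> ideals n"
    then have fin: "finite D" and card: "card D = n" and ideal: "order_ideal D"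
      unfolding ideals_def by auto
    have "r \<le> n \<and> c \<le> n" if "(r, c) \<in> D" for r c
    proof -
      have "(\<lambda>x. (x, c)) ` {..r} \<subseteq> D" "(\<lambda>y. (r, y)) ` {..c} \<subseteq> D"
        using order_idealD[OF ideal that] by auto
      then have "card ((\<lambda>x. (x, c)) ` {..r}) \<le> n" "card ((\<lambda>y. (r, y)) ` {..c}) \<le> n"
        using card_mono[OF fin] card by auto
      then show ?thesis by (simp add: card_image inj_on_def)
    qed
    then show "D \<in> Pow ({..n} \<times> {..n})" by auto
  qed
qed simp

lemma growth_count_pos: "finite D \<Longrightarrow> order_ideal D \<Longrightarrow> growth_count D > 0"
  unfolding growth_count_def using growth_exists[of D] finite_growths[of D]
  by (simp add: card_gt_0_iff)

lemma growth_count_empty: "growth_count {} = 1"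
proof -
  have "{xs. growth xs \<and> set xs = {}} = {[]}" using growth_Nil by auto
  then show ?thesis unfolding growth_count_def by simp
qed

lemma growth_count_rec:
  assumes "finite D" "order_ideal D" "D \<noteq> {}"
  shows "growth_count D = (\<Sum>b\<in>removable D. growth_count (D - {b}))"
proof -
  have eq: "{xs. growth xs \<and> set xs = D} =
      (\<Union>b\<in>removable D. (\<lambda>xs. xs @ [b]) ` {xs. growth xs \<and> set xs = D - {b}})" (is "?L = ?R")
  proof (rule Set.set_eqI, rule iffI)
    fix xs assume a: "xs \<in> ?L"
    then obtain ys b where xs: "xs = ys @ [b]" using assms(3) by (cases xs rule: rev_cases) auto
    have g: "growth ys" "b \<notin> set ys" using a xs by (auto simp: growth_snoc_iff)
    have "set ys = D - {b}" "b \<in> D" using a xs g by auto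
    moreover from this have "b \<in> removable D"
      unfolding removable_def using growth_order_ideal[OF g(1)] by simp
    ultimately show "xs \<in> ?R" using xs g by blast
  next
    fix xs assume "xs \<in> ?R"
    then obtain b ys where b: "b \<in> removable D" "xs = ys @ [b]" "growth ys" "set ys = D - {b}"
      by blast
    then have "b \<in> D" unfolding removable_def by simp
    then show "xs \<in> ?L" using b assms(2) by (auto simp: growth_snoc_iff insert_absorb)
  qed
  have fin: "finite (removable D)" using assms(1) unfolding removable_def by simp
  have "growth_count D =
      (\<Sum>b\<in>removable D. card ((\<lambda>xs. xs @ [b]) ` {xs. growth xs \<and> set xs = D - {b}}))"
    unfolding growth_count_def eq using fin assms(1)
    by (intro card_UN_disjoint) (auto intro!: finite_imageI finite_growths)
  also have "\<dots> = (\<Sum>b\<in>removable D. growth_count (D - {b}))"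
    unfolding growth_count_def by (intro sum.cong card_image) (auto simp: inj_on_def)
  finally show ?thesis .
qed

lemma finite_removable: "finite D \<Longrightarrow> finite (removable D)"
  unfolding removable_def by simp

text \<open>A removable box at the end of row \<open>r\<close> makes room for an addable one at the end of row \<open>r + 1\<close>;
  the first row can always be extended.\<close>

lemma addable_removable:
  assumes "finite D" "order_ideal D"
  shows "finite (addable D) \<and> card (addable D) = Suc (card (removable D))"
proof -
  obtain len where row: "\<And>r c. (r, c) \<in> D \<longleftrightarrow> c < len r"
    and anti': "\<And>r r'. r \<le> r' \<Longrightarrow> len r' \<le> len r"
    using order_ideal_rows[OF assms] by blast
  have add: "addable D = {(r, c). c = len r \<and> (r = 0 \<or> len r < len (r - 1))}" (is "_ = ?A")
  proof (rule Set.set_eqI, rule iffI)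
    fix b assume b: "b \<in> addable D"
    obtain r c where rc: "b = (r, c)" by (cases b)
    have nb: "(r, c) \<notin> D" and ib: "order_ideal (insert (r, c) D)" using b rc unfolding addable_def by auto
    have "c \<ge> len r" using nb row by auto
    moreover have "\<not> c > len r"
      using order_idealD[OF ib, of r c r "len r"] row[of r "len r"] by auto
    ultimately have c: "c = len r" by simp
    have "len r < len (r - 1)" if "r \<noteq> 0"
      using order_idealD[OF ib, of r c "r - 1" c] row[of "r - 1" c] c that by auto
    then show "b \<in> ?A" using rc c by auto
  next
    fix b assume "b \<in> ?A"
    then obtain r where b: "b = (r, len r)" and r: "r = 0 \<or> len r < len (r - 1)" by auto
    have "order_ideal (insert b D)" unfolding order_ideal_def
    proof (intro allI impI)
      fix x y x' y' assume a: "(x, y) \<in> insert b D" "x' \<le> x" "y' \<le> y"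
      show "(x', y') \<in> insert b D"
      proof (cases "(x, y) \<in> D")
        case True
        then show ?thesis using a assms(2) order_idealD by blast
      next
        case False
        then have xy: "x = r" "y = len r" using a b by auto
        show ?thesis
        proof (cases "x' = r")
          case True
          then show ?thesis using a xy row b by (cases "y' = len r") auto
        next
          case False
          then have "x' \<le> r - 1" "r \<noteq> 0" using a xy by auto
          then have "y' < len x'" using anti'[of x' "r - 1"] r a xy by auto
          then show ?thesis using row by auto
        qed
      qed
    qed
    then show "b \<in> addable D" using b row unfolding addable_def by auto
  qed
  have rem: "removable D = {(r, c). Suc c = len r \<and> len (Suc r) < len r}" (is "_ = ?R")
  proof (rule Set.set_eqI, rule iffI)
    fix b assume b: "b \<in> removable D"
    obtain r c where rc: "b = (r, c)" by (cases b)
    have nb: "(r, c) \<in> D" and ib: "order_ideal (D - {(r, c)})" using b rc unfolding removable_def by auto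
    have "\<not> Suc c < len r"
      using order_idealD[OF ib, of r "Suc c" r c] row[of r "Suc c"] by auto
    then have c: "Suc c = len r" using nb row[of r c] by simp
    have "\<not> c < len (Suc r)"
      using order_idealD[OF ib, of "Suc r" c r c] row[of "Suc r" c] by auto
    then show "b \<in> ?R" using rc c by auto
  next
    fix b assume "b \<in> ?R"
    then obtain r c where b: "b = (r, c)" and r: "Suc c = len r" "len (Suc r) < len r" by auto
    have "order_ideal (D - {b})" unfolding order_ideal_def
    proof (intro allI impI)
      fix x y x' y' assume a: "(x, y) \<in> D - {b}" "x' \<le> x" "y' \<le> y"
      have "(x', y') \<noteq> (r, c)"
      proof
        assume "(x', y') = (r, c)"
        then have le: "r \<le> x" "c \<le> y" using a by auto
        have "y < len x" using a row by auto
        moreover have "x \<noteq> r \<Longrightarrow> len x \<le> len (Suc r)" using anti'[of "Suc r" x] le by auto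
        ultimately show False using le r a b by (cases "x = r") auto
      qed
      then show "(x', y') \<in> D - {b}" using a b assms(2) order_idealD by blast
    qed
    then show "b \<in> removable D" using b r row unfolding removable_def by auto
  qed
  define h where "h b = (Suc (fst b), len (Suc (fst b)))" for b :: "nat \<times> nat"
  have "addable D = insert (0, len 0) (h ` removable D)"
  proof (rule Set.set_eqI, rule iffI)
    fix b assume "b \<in> addable D"
    then obtain r where b: "b = (r, len r)" and r: "r = 0 \<or> len r < len (r - 1)"
      unfolding add by auto
    show "b \<in> insert (0, len 0) (h ` removable D)"
    proof (cases r)
      case (Suc s)
      then have "len (Suc s) < len s" using r by auto
      then have "(s, len s - 1) \<in> removable D" unfolding rem by auto
      then show ?thesis using b Suc unfolding h_def by force
    qed (use b in simp)
  next
    fix b assume "b \<in> insert (0, len 0) (h ` removable D)"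
    then show "b \<in> addable D" unfolding add rem h_def by auto
  qed
  moreover have "inj_on h (removable D)" unfolding inj_on_def rem h_def by auto
  moreover have "(0, len 0) \<notin> h ` removable D" unfolding h_def by auto
  ultimately show ?thesis using finite_removable[OF assms(1)] by (simp add: card_image)
qed

text \<open>Union and intersection of \<open>D\<close> with the ideal obtained by the other route
  give the missing corner of the square. Together with the excess of one addable box this is the
  relation DU - UD = I for the down and up operators of Young's lattice.\<close>

lemma addable_then_removable:
  assumes "order_ideal D"
  shows "b \<in> addable D \<and> a \<in> removable (insert b D) \<and> a \<noteq> b \<longleftrightarrow>
         a \<in> removable D \<and> b \<in> addable (D - {a}) \<and> b \<noteq> a"
proof
  assume a: "b \<in> addable D \<and> a \<in> removable (insert b D) \<and> a \<noteq> b"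
  have "order_ideal (D \<inter> (insert b D - {a}))"
    using a assms order_ideal_Int unfolding removable_def by auto
  moreover have "D \<inter> (insert b D - {a}) = D - {a}" by auto
  moreover have "insert b D - {a} = insert b (D - {a})" using a by auto
  ultimately show "a \<in> removable D \<and> b \<in> addable (D - {a}) \<and> b \<noteq> a"
    using a unfolding removable_def addable_def by auto
next
  assume a: "a \<in> removable D \<and> b \<in> addable (D - {a}) \<and> b \<noteq> a"
  have "order_ideal (D \<union> insert b (D - {a}))"
    using a assms unfolding addable_def by (intro order_ideal_Un) auto
  moreover have "D \<union> insert b (D - {a}) = insert b D" by blast
  moreover have "insert b D - {a} = insert b (D - {a})" using a by auto
  ultimately show "b \<in> addable D \<and> a \<in> removable (insert b D) \<and> a \<noteq> b"
    using a unfolding removable_def addable_def by auto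
qed

text \<open>Expand each summand by its removable boxes. Removing the box just added gives
  \<open>growth_count D\<close>, once for each addable box; in the other terms the two operations
  are swapped, so that the induction hypothesis applies to \<open>D - {a}\<close>, minus the one
  term that adds \<open>a\<close> back. As there is one more addable than removable box, the terms
  \<open>growth_count D\<close> leave exactly one over.\<close>

lemma sum_growth_count_addable:
  assumes "finite D" "order_ideal D"
  shows "(\<Sum>b\<in>addable D. growth_count (insert b D)) = Suc (card D) * growth_count D"
  using assms
proof (induction "card D" arbitrary: D)
  case (0 D)
  then have "D = {}" by simp
  moreover have ideal: "order_ideal {(0, 0)}" unfolding order_ideal_def by auto
  moreover have "addable {} = {(0, 0)}"
  proof -
    have "b = (0, 0)" if "order_ideal {b}" for b
      using order_idealD[OF that, of "fst b" "snd b" 0 0] by auto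
    then show ?thesis using ideal unfolding addable_def by blast
  qed
  moreover have "growth_count {(0, 0)} = 1"
  proof -
    have "removable {(0, 0)} = {(0, 0)}" unfolding removable_def by (auto simp: order_ideal_empty)
    then show ?thesis
      using growth_count_rec[of "{(0, 0)}"] growth_count_empty ideal by simp
  qed
  ultimately show ?case by (simp add: growth_count_empty)
next
  case (Suc m D)
  note fin = Suc.prems(1) and ideal = Suc.prems(2)
  have "D \<noteq> {}" using Suc.hyps(2) by auto
  have fa: "finite (addable D)" and ca: "card (addable D) = Suc (card (removable D))"
    using addable_removable[OF fin ideal] by auto
  have sub: "finite (D - {a})" "order_ideal (D - {a})" "m = card (D - {a})" "a \<in> addable (D - {a})"
    if "a \<in> removable D" for a
    using that fin ideal Suc.hyps(2) unfolding removable_def addable_def by (auto simp: insert_absorb)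
  have "(\<Sum>b\<in>addable D. growth_count (insert b D)) =
      (\<Sum>b\<in>addable D. growth_count D +
        (\<Sum>a\<in>removable (insert b D) - {b}. growth_count (insert b D - {a})))"
  proof (rule sum.cong[OF refl])
    fix b assume b: "b \<in> addable D"
    then have "b \<in> removable (insert b D)" "insert b D - {b} = D"
      using ideal unfolding addable_def removable_def by auto
    moreover have "growth_count (insert b D) =
        (\<Sum>a\<in>removable (insert b D). growth_count (insert b D - {a}))"
      using b fin unfolding addable_def by (intro growth_count_rec) auto
    ultimately show "growth_count (insert b D) = growth_count D +
        (\<Sum>a\<in>removable (insert b D) - {b}. growth_count (insert b D - {a}))"
      using sum.remove[OF finite_removable, of "insert b D" b "\<lambda>a. growth_count (insert b D - {a})"] fin
      by simp
  qed
  also have "\<dots> = card (addable D) * growth_count D +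
      (\<Sum>b\<in>addable D. \<Sum>a\<in>removable (insert b D) - {b}. growth_count (insert b D - {a}))"
    by (simp add: sum.distrib)
  also have "(\<Sum>b\<in>addable D. \<Sum>a\<in>removable (insert b D) - {b}. growth_count (insert b D - {a})) =
      (\<Sum>a\<in>removable D. \<Sum>b\<in>addable (D - {a}) - {a}. growth_count (insert b (D - {a})))"
  proof -
    have "(\<Sum>b\<in>addable D. \<Sum>a\<in>removable (insert b D) - {b}. growth_count (insert b D - {a})) =
        (\<Sum>(b, a)\<in>Sigma (addable D) (\<lambda>b. removable (insert b D) - {b}). growth_count (insert b D - {a}))"
      using fa fin by (intro sum.Sigma) (auto intro: finite_removable)
    also have "\<dots> = (\<Sum>(a, b)\<in>Sigma (removable D) (\<lambda>a. addable (D - {a}) - {a}).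
        growth_count (insert b (D - {a})))"
    proof (rule sum.reindex_bij_witness[of _ "\<lambda>(a, b). (b, a)" "\<lambda>(a, b). (b, a)"])
      fix p assume "p \<in> Sigma (addable D) (\<lambda>b. removable (insert b D) - {b})"
      then obtain b a where p: "p = (b, a)" "b \<in> addable D" "a \<in> removable (insert b D)" "a \<noteq> b"
        by auto
      show "(case case p of (a, b) \<Rightarrow> (b, a) of (a, b) \<Rightarrow> (b, a)) = p" using p by simp
      show "(case p of (a, b) \<Rightarrow> (b, a)) \<in> Sigma (removable D) (\<lambda>a. addable (D - {a}) - {a})"
        using p addable_then_removable[OF ideal, of b a] by auto
      show "(case case p of (a, b) \<Rightarrow> (b, a) of (a, b) \<Rightarrow> growth_count (insert b (D - {a}))) =
          (case p of (b, a) \<Rightarrow> growth_count (insert b D - {a}))"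
        using p by (simp add: insert_Diff_if)
    next
      fix p assume "p \<in> Sigma (removable D) (\<lambda>a. addable (D - {a}) - {a})"
      then obtain b a where p: "p = (a, b)" "a \<in> removable D" "b \<in> addable (D - {a})" "b \<noteq> a"
        by auto
      show "(case case p of (a, b) \<Rightarrow> (b, a) of (a, b) \<Rightarrow> (b, a)) = p" using p by simp
      show "(case p of (a, b) \<Rightarrow> (b, a)) \<in> Sigma (addable D) (\<lambda>b. removable (insert b D) - {b})"
        using p addable_then_removable[OF ideal, of b a] by auto
    qed
    also have "\<dots> = (\<Sum>a\<in>removable D. \<Sum>b\<in>addable (D - {a}) - {a}. growth_count (insert b (D - {a})))"
      using finite_removable[OF fin] addable_removable sub by (intro sum.Sigma[symmetric]) auto
    finally show ?thesis .
  qed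
  also have "\<dots> = (\<Sum>a\<in>removable D. Suc m * growth_count (D - {a}) - growth_count D)"
  proof (rule sum.cong[OF refl])
    fix a assume a: "a \<in> removable D"
    then have "a \<in> D" unfolding removable_def by simp
    have "(\<Sum>b\<in>addable (D - {a}). growth_count (insert b (D - {a}))) = Suc m * growth_count (D - {a})"
      using Suc.hyps(1)[OF sub(3)[OF a] sub(1,2)[OF a]] sub(3)[OF a] by simp
    then show "(\<Sum>b\<in>addable (D - {a}) - {a}. growth_count (insert b (D - {a}))) =
        Suc m * growth_count (D - {a}) - growth_count D"
      using sum_diff1_nat[of "\<lambda>b. growth_count (insert b (D - {a}))" "addable (D - {a})" a]
        sub(4)[OF a] \<open>a \<in> D\<close> by (simp add: insert_absorb)
  qed
  also have "\<dots> = (\<Sum>a\<in>removable D. Suc m * growth_count (D - {a})) - card (removable D) * growth_count D"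
  proof -
    \<comment> \<open>The subtraction is truncated, so it distributes over the sum only because no
      summand is cut off: \<open>growth_count D\<close> is itself a term of the sum that the
      induction hypothesis evaluates.\<close>
    have "growth_count D \<le> Suc m * growth_count (D - {a})" if a: "a \<in> removable D" for a
    proof -
      have "a \<in> D" using a unfolding removable_def by simp
      have "growth_count (insert a (D - {a})) \<le> (\<Sum>b\<in>addable (D - {a}). growth_count (insert b (D - {a})))"
        using addable_removable[OF sub(1,2)[OF a]] sub(4)[OF a] by (intro member_le_sum) auto
      then show ?thesis
        using Suc.hyps(1)[OF sub(3)[OF a] sub(1,2)[OF a]] sub(3)[OF a] \<open>a \<in> D\<close>
        by (simp add: insert_absorb)
    qed
    then show ?thesis by (subst sum_subtractf_nat) auto
  qed
  also have "(\<Sum>a\<in>removable D. Suc m * growth_count (D - {a})) = Suc m * growth_count D"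
    using growth_count_rec[OF fin ideal \<open>D \<noteq> {}\<close>] by (simp add: sum_distrib_left)
  finally have sum: "(\<Sum>b\<in>addable D. growth_count (insert b D)) = card (addable D) * growth_count D +
      (Suc m * growth_count D - card (removable D) * growth_count D)" .
  have "card (removable D) \<le> Suc m"
    using card_mono[OF fin, of "removable D"] Suc.hyps(2) unfolding removable_def by auto
  then have "card (removable D) * growth_count D \<le> Suc m * growth_count D" by (intro mult_right_mono) auto
  then show ?case using sum ca Suc.hyps(2) by (simp add: algebra_simps)
qed

text \<open>One factor of each square is expanded by removing a box, which turns the sum into one
  over the edges between two levels of Young's lattice. Summed from the lower end of the edges, it
  gains the factor \<open>Suc n\<close>.\<close>

lemma sum_growth_count_squares: "(\<Sum>D\<in>ideals n. (growth_count D)\<^sup>2) = fact n"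
proof (induction n)
  case 0
  have "ideals 0 = {{}}" unfolding ideals_def by (auto simp: order_ideal_empty)
  then show ?case by (simp add: growth_count_empty)
next
  case (Suc n)
  have "(\<Sum>D\<in>ideals (Suc n). (growth_count D)\<^sup>2) =
      (\<Sum>D\<in>ideals (Suc n). \<Sum>a\<in>removable D. growth_count D * growth_count (D - {a}))"
  proof (rule sum.cong[OF refl])
    fix D assume "D \<in> ideals (Suc n)"
    then have "finite D" "order_ideal D" "D \<noteq> {}" unfolding ideals_def by auto
    then show "(growth_count D)\<^sup>2 = (\<Sum>a\<in>removable D. growth_count D * growth_count (D - {a}))"
      using growth_count_rec by (simp add: power2_eq_square sum_distrib_left[symmetric])
  qed
  also have "\<dots> = (\<Sum>(D, a)\<in>Sigma (ideals (Suc n)) removable. growth_count D * growth_count (D - {a}))"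
    using finite_ideals by (intro sum.Sigma) (auto simp: ideals_def intro: finite_removable)
  also have "\<dots> = (\<Sum>(E, b)\<in>Sigma (ideals n) addable. growth_count (insert b E) * growth_count E)"
  proof (rule sum.reindex_bij_witness[of _ "\<lambda>(E, b). (insert b E, b)" "\<lambda>(D, a). (D - {a}, a)"])
    fix p assume "p \<in> Sigma (ideals (Suc n)) removable"
    then obtain D a where p: "p = (D, a)" "D \<in> ideals (Suc n)" "a \<in> removable D" by auto
    then have a: "insert a (D - {a}) = D" unfolding removable_def by auto
    show "(case case p of (D, a) \<Rightarrow> (D - {a}, a) of (E, b) \<Rightarrow> (insert b E, b)) = p"
      using a p(1) by simp
    show "(case p of (D, a) \<Rightarrow> (D - {a}, a)) \<in> Sigma (ideals n) addable"
      using a p unfolding ideals_def addable_def removable_def by auto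
    show "(case case p of (D, a) \<Rightarrow> (D - {a}, a) of
        (E, b) \<Rightarrow> growth_count (insert b E) * growth_count E) =
        (case p of (D, a) \<Rightarrow> growth_count D * growth_count (D - {a}))"
      using a p(1) by simp
  next
    fix p assume "p \<in> Sigma (ideals n) addable"
    then obtain E b where p: "p = (E, b)" "E \<in> ideals n" "b \<in> addable E" by auto
    then have b: "insert b E - {b} = E" unfolding addable_def by auto
    show "(case case p of (E, b) \<Rightarrow> (insert b E, b) of (D, a) \<Rightarrow> (D - {a}, a)) = p"
      using b p(1) by simp
    show "(case p of (E, b) \<Rightarrow> (insert b E, b)) \<in> Sigma (ideals (Suc n)) removable"
      using b p unfolding ideals_def addable_def removable_def by auto
  qed
  also have "\<dots> = (\<Sum>E\<in>ideals n. \<Sum>b\<in>addable E. growth_count (insert b E) * growth_count E)"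
    using finite_ideals addable_removable by (intro sum.Sigma[symmetric]) (auto simp: ideals_def)
  also have "\<dots> = (\<Sum>E\<in>ideals n. Suc n * (growth_count E)\<^sup>2)"
  proof (rule sum.cong[OF refl])
    fix E assume "E \<in> ideals n"
    then show "(\<Sum>b\<in>addable E. growth_count (insert b E) * growth_count E) = Suc n * (growth_count E)\<^sup>2"
      using sum_growth_count_addable[of E]
      by (simp add: ideals_def power2_eq_square sum_distrib_right[symmetric]) (simp add: algebra_simps)
  qed
  also have "\<dots> = fact (Suc n)" unfolding sum_distrib_left[symmetric] Suc by simp
  finally show ?case .
qed

section \<open>Jucys-Murphy elements\<close>

text \<open>\<open>tr i k\<close> stands for the action of the transposition \<open>(i k)\<close> on \<open>X\<close>. The laws are invariant under
  passing to the opposite group, so that they cover left and right translation at the same time.\<close>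

locale transposition_action =
  fixes n :: nat and X :: "'x set" and tr :: "nat \<Rightarrow> nat \<Rightarrow> 'x \<Rightarrow> 'x"
  assumes tr_closed: "i \<in> {1..n} \<Longrightarrow> j \<in> {1..n} \<Longrightarrow> x \<in> X \<Longrightarrow> tr i j x \<in> X"
    and tr_sym: "tr i j x = tr j i x"
    and tr_tr: "tr i j (tr i j x) = x"
    and tr_conj: "tr i j (tr k l x) = tr (transpose i j k) (transpose i j l) (tr i j x)"
begin

text \<open>\<open>v\<close> is a joint eigenvector of the Jucys-Murphy elements with eigenvalues \<open>c 1, \<dots>, c n\<close>.\<close>

definition jm_eigen :: "(nat \<Rightarrow> real) \<Rightarrow> ('x \<Rightarrow> real) \<Rightarrow> bool" where
  "jm_eigen c v \<longleftrightarrow> (\<forall>k\<in>{1..n}. \<forall>x\<in>X. (\<Sum>i\<in>{1..<k}. v (tr i k x)) = c k * v x)"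

definition nonzero :: "('x \<Rightarrow> real) \<Rightarrow> bool" where
  "nonzero v \<longleftrightarrow> (\<exists>x\<in>X. v x \<noteq> 0)"

lemma jm_eigenD: "jm_eigen c v \<Longrightarrow> k \<in> {1..n} \<Longrightarrow> x \<in> X \<Longrightarrow> (\<Sum>i\<in>{1..<k}. v (tr i k x)) = c k * v x"
  unfolding jm_eigen_def by blast

lemma jm_eigen_cong:
  assumes "jm_eigen c v" "\<And>k. k \<in> {1..n} \<Longrightarrow> c k = c' k"
  shows "jm_eigen c' v"
  using assms unfolding jm_eigen_def by simp

text \<open>The transposition s_k commutes with J_j unless j is k or k+1, and s_k J_k = J_{k+1} s_k
  - 1. The stray term \<open>v x\<close> in these two cases is compensated by 1/d, which fact
  \<open>e\<close> expresses.\<close>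

lemma jm_eigen_swap:
  assumes eig: "jm_eigen c v" and k: "1 \<le> k" "k < n" and d: "d = c (Suc k) - c k" "d \<noteq> 0"
  shows "jm_eigen (c \<circ> transpose k (Suc k)) (\<lambda>x. v (tr k (Suc k) x) - 1 / d * v x)"
  unfolding jm_eigen_def
proof (intro ballI)
  fix j x assume j: "j \<in> {1..n}" and x: "x \<in> X"
  define t where "t = transpose k (Suc k)"
  define y where "y = tr k (Suc k) x"
  have y: "y \<in> X" unfolding y_def using k x by (intro tr_closed) auto
  have ty: "tr k (Suc k) y = x" unfolding y_def by (rule tr_tr)
  have e: "1 / d * (c k * v x) = 1 / d * (c (Suc k) * v x) - v x"
  proof -
    have "c (Suc k) = c k + d" using d by simp
    then show ?thesis using d(2) by (simp add: field_simps)
  qed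
  have conj: "tr k (Suc k) (tr i j x) = tr (t i) (t j) y" for i
    unfolding t_def y_def by (rule tr_conj)
  have tyx: "v (tr (Suc k) k y) = v x" using ty tr_sym[of k "Suc k" y] by simp
  have "(\<Sum>i\<in>{1..<j}. v (tr k (Suc k) (tr i j x)) - 1 / d * v (tr i j x)) =
      (\<Sum>i\<in>{1..<j}. v (tr (t i) (t j) y)) - 1 / d * (c j * v x)"
    unfolding sum_subtractf sum_distrib_left[symmetric] jm_eigenD[OF eig j x] conj ..
  also have "\<dots> = c (t j) * (v y - 1 / d * v x)"
  proof -
    consider "j < k" | "j = k" | "j = Suc k" | "j > Suc k" by linarith
    then show ?thesis
    proof cases
      case 1
      then have t: "t j = j" "\<And>i. i \<in> {1..<j} \<Longrightarrow> t i = i" unfolding t_def by (auto simp: transpose_def)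
      then have "(\<Sum>i\<in>{1..<j}. v (tr (t i) (t j) y)) = (\<Sum>i\<in>{1..<j}. v (tr i j y))"
        by (intro sum.cong) auto
      then show ?thesis using t jm_eigenD[OF eig j y] by (simp add: algebra_simps)
    next
      case 2
      then have t: "t j = Suc k" "\<And>i. i \<in> {1..<j} \<Longrightarrow> t i = i" unfolding t_def by (auto simp: transpose_def)
      have "(\<Sum>i\<in>{1..<j}. v (tr (t i) (t j) y)) = (\<Sum>i\<in>{1..<k}. v (tr i (Suc k) y))"
        using t 2 by (intro sum.cong) auto
      also have "\<dots> = c (Suc k) * v y - v x"
      proof -
        have "{1..<Suc k} = insert k {1..<k}" using k by auto
        then show ?thesis using jm_eigenD[OF eig _ y, of "Suc k"] k ty by simp
      qed
      finally have sum: "(\<Sum>i\<in>{1..<j}. v (tr (t i) (t j) y)) = c (Suc k) * v y - v x" .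
      show ?thesis unfolding sum unfolding t(1) using e 2 by (simp add: algebra_simps)
    next
      case 3
      have "t j = k" "\<And>i. i \<in> {1..<k} \<Longrightarrow> t i = i" "t k = Suc k" using 3 unfolding t_def by (auto simp: transpose_def)
      moreover have "{1..<j} = insert k {1..<k}" using 3 k by auto
      ultimately have sum: "(\<Sum>i\<in>{1..<j}. v (tr (t i) (t j) y)) = c k * v y + v x"
        using jm_eigenD[OF eig _ y, of k] k tyx by simp
      show ?thesis unfolding sum unfolding \<open>t j = k\<close> using e 3 by (simp add: algebra_simps)
    next
      case 4
      then have t: "t j = j" unfolding t_def by (auto simp: transpose_def)
      \<comment> \<open>Above k+1 conjugation only permutes the summands of J_j, as k and k+1 both
        lie below \<open>j\<close>.\<close>
      have "bij_betw t {1..<j} {1..<j}"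
        unfolding t_def using 4 k by (intro permutes_imp_bij permutes_swap_id) auto
      then have "(\<Sum>i\<in>{1..<j}. v (tr (t i) j y)) = (\<Sum>i\<in>{1..<j}. v (tr i j y))"
        by (rule sum.reindex_bij_betw)
      then show ?thesis using t jm_eigenD[OF eig j y] by (simp add: algebra_simps)
    qed
  qed
  finally show "(\<Sum>i\<in>{1..<j}. v (tr k (Suc k) (tr i j x)) - 1 / d * v (tr i j x)) =
      (c \<circ> transpose k (Suc k)) j * (v (tr k (Suc k) x) - 1 / d * v x)"
    by (simp add: t_def y_def)
qed

text \<open>If the new vector vanished, s_k would act on \<open>v\<close> as the scalar 1/d; since
  s_k is an involution, d would be 1 or -1.\<close>

lemma nonzero_swap:
  assumes "nonzero v" "1 \<le> k" "k < n" "\<bar>d\<bar> > 1"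
  shows "nonzero (\<lambda>x. v (tr k (Suc k) x) - 1 / d * v x)"
proof (rule ccontr)
  assume "\<not> ?thesis"
  then have eq: "v (tr k (Suc k) x) = 1 / d * v x" if "x \<in> X" for x
    using that unfolding nonzero_def by auto
  obtain x where x: "x \<in> X" "v x \<noteq> 0" using assms(1) unfolding nonzero_def by blast
  have "tr k (Suc k) x \<in> X" using assms x by (intro tr_closed) auto
  from eq[OF this] have "v x = 1 / d * (1 / d * v x)" using eq[OF x(1)] tr_tr by metis
  then have "d * d = 1" using x assms(4) by (auto simp: field_simps)
  then show False using assms(4) by (auto simp: square_eq_1_iff)
qed

end

section \<open>Content vectors and transport of eigenvectors along exchanges\<close>

definition word_content :: "(nat \<times> nat) list \<Rightarrow> nat \<Rightarrow> real" where
  "word_content xs k = real_of_int (content_of (xs ! (k - 1)))"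

lemma growth_step_content:
  assumes "growth_step xs ys"
  obtains k where "1 \<le> k" "k < length xs" "length ys = length xs"
    "\<bar>word_content xs (Suc k) - word_content xs k\<bar> > 1"
    "\<And>j. j \<in> {1..length xs} \<Longrightarrow> (word_content xs \<circ> transpose k (Suc k)) j = word_content ys j"
proof -
  obtain us a b vs where xy: "growth xs" "growth ys" "xs = us @ [a, b] @ vs" "ys = us @ [b, a] @ vs"
    using assms unfolding growth_step_def by blast
  \<comment> \<open>The exchanged boxes have list positions \<open>length us\<close> and
    \<open>length us + 1\<close>, but entries start at 1. Both boxes are addable to
    \<open>set us\<close>, which gives the gap in contents.\<close>
  define k where "k = Suc (length us)"
  have "growth ((us @ [a]) @ [b])" "growth ((us @ [b]) @ [a])"
    using xy growth_prefix[of "us @ [a, b]" vs] growth_prefix[of "us @ [b, a]" vs] by auto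
  then have "\<bar>content_of b - content_of a\<bar> \<ge> 2"
    using content_addable[of a "set us" b] unfolding growth_snoc_iff by auto
  then have "\<bar>word_content xs (Suc k) - word_content xs k\<bar> > 1"
    unfolding word_content_def k_def xy(3) by (simp add: nth_append)
  moreover have "(word_content xs \<circ> transpose k (Suc k)) j = word_content ys j"
    if "j \<in> {1..length xs}" for j
  proof -
    consider "j < k" | "j = k" | "j = Suc k" | "j > Suc k" by linarith
    then show ?thesis
    proof cases
      case 1
      then have "j - 1 < length us" using that unfolding k_def by auto
      then show ?thesis using 1 xy by (simp add: word_content_def nth_append transpose_def)
    next
      case 4
      then obtain m where m: "j = Suc (length us + 2 + m)"
        unfolding k_def by (metis Suc_leI add_2_eq_Suc' add_Suc less_iff_Suc_add)
      then show ?thesis using 4 xy by (simp add: word_content_def nth_append transpose_def k_def)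
    qed (use xy in \<open>auto simp: word_content_def nth_append transpose_def k_def\<close>)
  qed
  moreover have "1 \<le> k" "k < length xs" "length ys = length xs" using xy unfolding k_def by auto
  ultimately show ?thesis using that by blast
qed

context transposition_action begin

text \<open>The predicate \<open>U\<close> is an invariant carried along the path. It will be the
  eigenvector property for the translation on the other side.\<close>

lemma jm_eigen_growth_steps:
  assumes "growth_step\<^sup>*\<^sup>* xs ys" "length xs = n" "jm_eigen (word_content xs) v" "nonzero v" "U v"
    and U: "\<And>u k a. U u \<Longrightarrow> 1 \<le> k \<Longrightarrow> k < n \<Longrightarrow> U (\<lambda>x. u (tr k (Suc k) x) - a * u x)"
  shows "length ys = n \<and> (\<exists>w. jm_eigen (word_content ys) w \<and> nonzero w \<and> U w)"
  using assms(1)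
proof (induction rule: rtranclp_induct)
  case base
  then show ?case using assms by blast
next
  case (step ys zs)
  then obtain w where len: "length ys = n" and w: "jm_eigen (word_content ys) w" "nonzero w" "U w" by blast
  obtain k where k: "1 \<le> k" "k < length ys" "length zs = length ys"
    "\<bar>word_content ys (Suc k) - word_content ys k\<bar> > 1"
    "\<And>j. j \<in> {1..length ys} \<Longrightarrow> (word_content ys \<circ> transpose k (Suc k)) j = word_content zs j"
    using growth_step_content[OF step.hyps(2)] by metis
  define d where "d = word_content ys (Suc k) - word_content ys k"
  define w' where "w' = (\<lambda>x. w (tr k (Suc k) x) - 1 / d * w x)"
  have "d \<noteq> 0" using k(4) unfolding d_def by auto
  then have "jm_eigen (word_content ys \<circ> transpose k (Suc k)) w'"
    unfolding w'_def using jm_eigen_swap[OF w(1)] k len d_def by simp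
  then have "jm_eigen (word_content zs) w'" by (rule jm_eigen_cong) (use k(5) len in auto)
  moreover have "nonzero w'" unfolding w'_def using nonzero_swap[OF w(2)] k len d_def by simp
  moreover have "U w'" unfolding w'_def by (rule U[OF w(3) k(1)]) (use k len in simp)
  ultimately show ?case using k len by auto
qed

end

section \<open>Vandermonde products\<close>

definition vander :: "nat set \<Rightarrow> (nat \<Rightarrow> real) \<Rightarrow> real" where
  "vander A g = (\<Prod>(p, q)\<in>{(p, q). p \<in> A \<and> q \<in> A \<and> p < q}. g q - g p)"

text \<open>This isolates \<open>g l\<close>: the product is a polynomial in that one value. The
  sign counts the elements above \<open>l\<close> and does not depend on \<open>g\<close>, so it
  cancels when different arguments are compared.\<close>

lemma vander_insert:
  assumes "finite A" "l \<notin> A"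
  shows "vander (insert l A) g = (\<Prod>m\<in>A. if m < l then 1 else - 1) * vander A g * (\<Prod>m\<in>A. g l - g m)"
proof -
  define S where "S B = {(p, q). p \<in> B \<and> q \<in> B \<and> p < q}" for B :: "nat set"
  define h where "h m = (if m < l then (m, l) else (l, m))" for m
  have fin: "finite (S A)"
    unfolding S_def by (rule finite_subset[OF _ finite_cartesian_product[OF assms(1) assms(1)]]) auto
  have "S (insert l A) \<subseteq> S A \<union> h ` A"
  proof
    fix p assume "p \<in> S (insert l A)"
    then obtain a b where p: "p = (a, b)" "a \<in> insert l A" "b \<in> insert l A" "a < b"
      unfolding S_def by blast
    show "p \<in> S A \<union> h ` A"
    proof (cases "a = l")
      case True
      then have "p = h b" "b \<in> A" using p unfolding h_def by auto
      then show ?thesis by blast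
    next
      case False
      show ?thesis
      proof (cases "b = l")
        case True
        then have "p = h a" "a \<in> A" using p unfolding h_def by auto
        then show ?thesis by blast
      qed (use False p in \<open>auto simp: S_def\<close>)
    qed
  qed
  moreover have "h m \<in> S (insert l A)" "h m \<notin> S A" if "m \<in> A" for m
    using that assms(2) unfolding h_def S_def by (cases "m < l"; cases "m = l"; simp)+
  moreover have "S A \<subseteq> S (insert l A)" unfolding S_def by auto
  ultimately have "S (insert l A) = S A \<union> h ` A" "S A \<inter> h ` A = {}" by auto
  moreover have "inj_on h A" unfolding h_def inj_on_def by (simp split: if_splits)
  moreover have "(case h m of (p, q) \<Rightarrow> g q - g p) = (if m < l then 1 else - 1) * (g l - g m)" for m
    unfolding h_def by simp
  ultimately have "vander (insert l A) g = vander A g * (\<Prod>m\<in>A. (if m < l then 1 else - 1) * (g l - g m))"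
    unfolding vander_def S_def[symmetric] using fin assms(1)
    by (simp add: prod.union_disjoint prod.reindex)
  then show ?thesis by (simp add: prod.distrib)
qed

lemma vander_cong: "(\<And>m. m \<in> A \<Longrightarrow> g m = h m) \<Longrightarrow> vander A g = vander A h"
  unfolding vander_def by (intro prod.cong) auto

lemma vander_nonzero:
  assumes "finite A" "inj_on g A"
  shows "vander A g \<noteq> 0"
proof -
  have "finite {(p, q). p \<in> A \<and> q \<in> A \<and> p < q}" 
    by (rule finite_subset[OF _ finite_cartesian_product[OF assms(1) assms(1)]]) auto
  moreover have "g q - g p \<noteq> 0" if "p \<in> A" "q \<in> A" "p < q" for p q
    using inj_onD[OF assms(2), of q p] that by auto
  ultimately show ?thesis unfolding vander_def by (auto simp: prod_zero_iff)
qed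

lemma vander_transpose_in:
  assumes "finite A" "l \<in> A" "k \<in> A" "l \<noteq> k"
  shows "vander A (g \<circ> transpose l k) = - vander A g"
proof -
  define B where "B = A - {l, k}"
  have B: "finite B" "l \<notin> insert k B" "k \<notin> B" "l \<notin> B" and A: "A = insert l (insert k B)"
    using assms unfolding B_def by auto
  have id: "(g \<circ> transpose l k) m = g m" if "m \<in> B" for m
    using that B by (auto simp: transpose_def)
  have "vander B (g \<circ> transpose l k) = vander B g" using id by (rule vander_cong)
  moreover have "(\<Prod>m\<in>B. a - (g \<circ> transpose l k) m) = (\<Prod>m\<in>B. a - g m)" for a
    using id by (intro prod.cong) auto
  ultimately show ?thesis using B unfolding A by (simp add: vander_insert prod.insert algebra_simps)
qed

text \<open>The transposition replaces the value \<open>g l\<close> by \<open>g k\<close>. The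
  quotient of the two products is the Lagrange basis polynomial of the node \<open>g l\<close>,
  evaluated at \<open>g k\<close>.\<close>

lemma vander_transpose_out:
  assumes "finite A" "l \<in> A" "k \<notin> A" "inj_on g A"
  shows "vander A (g \<circ> transpose l k) = vander A g * (\<Prod>m\<in>A - {l}. (g k - g m) / (g l - g m))"
proof -
  define B where "B = A - {l}"
  have B: "finite B" "l \<notin> B" "k \<notin> B" and A: "A = insert l B" using assms unfolding B_def by auto
  have id: "(g \<circ> transpose l k) m = g m" if "m \<in> B" for m
    using that B by (auto simp: transpose_def)
  have "vander B (g \<circ> transpose l k) = vander B g" using id by (rule vander_cong)
  moreover have "(\<Prod>m\<in>B. a - (g \<circ> transpose l k) m) = (\<Prod>m\<in>B. a - g m)" for a
    using id by (intro prod.cong) auto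
  moreover have "(\<Prod>m\<in>B. g l - g m) \<noteq> 0"
    using assms(4) B unfolding A by (auto simp: inj_on_def)
  ultimately show ?thesis unfolding B_def[symmetric] using B(1,2) 
    unfolding A by (simp add: vander_insert prod_dividef)
qed

section \<open>Interpolation and the Garnir relation\<close>

lemma lagrange_interpolation:
  fixes y :: "'i \<Rightarrow> real" and p :: "real poly"
  assumes "finite A" "inj_on y A" "degree p < card A"
  shows "(\<Sum>l\<in>A. poly p (y l) * (\<Prod>m\<in>A - {l}. (z - y m) / (y l - y m))) = poly p z"
proof -
  define q where "q = (\<Sum>l\<in>A. Polynomial.smult (poly p (y l)) (\<Prod>m\<in>A - {l}. Polynomial.smult (1 / (y l - y m)) [:- y m, 1:]))"
  have polyq: "poly q x = (\<Sum>l\<in>A. poly p (y l) * (\<Prod>m\<in>A - {l}. (x - y m) / (y l - y m)))" for x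
    unfolding q_def poly_sum poly_smult poly_prod by simp
  have "card A > 0" using assms(3) by simp
  have "degree q \<le> card A - 1"
    unfolding q_def
  proof (rule degree_sum_le[OF assms(1)])
    fix l assume l: "l \<in> A"
    have "degree (\<Prod>m\<in>A - {l}. Polynomial.smult (1 / (y l - y m)) [:- y m, 1:]) \<le>
        (\<Sum>m\<in>A - {l}. degree (Polynomial.smult (1 / (y l - y m)) [:- y m, 1:]))"
      using degree_prod_sum_le[of "A - {l}" "\<lambda>m. Polynomial.smult (1 / (y l - y m)) [:- y m, 1:]"] assms(1)
      by (simp add: o_def)
    also have "\<dots> \<le> (\<Sum>m\<in>A - {l}. 1)" by (intro sum_mono) simp
    finally have "degree (\<Prod>m\<in>A - {l}. Polynomial.smult (1 / (y l - y m)) [:- y m, 1:]) \<le> card A - 1"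
      using l assms(1) by simp
    then show "degree (Polynomial.smult (poly p (y l)) (\<Prod>m\<in>A - {l}. Polynomial.smult (1 / (y l - y m)) [:- y m, 1:])) \<le> card A - 1"
      by (meson degree_smult_le order_trans)
  qed
  then have deg: "degree q < card A" using \<open>card A > 0\<close> by simp
  have "q = p"
  proof (rule poly_eqI_degree[of "y ` A"])
    fix x assume "x \<in> y ` A"
    then obtain k where k: "k \<in> A" "x = y k" by blast
    have zero: "(\<Prod>m\<in>A - {l}. (x - y m) / (y l - y m)) = 0" if "l \<in> A - {k}" for l
      using that k assms(1) by (intro prod_zero) auto
    have one: "(\<Prod>m\<in>A - {k}. (x - y m) / (y k - y m)) = 1"
      using k assms(2) by (intro prod.neutral) (auto simp: inj_on_def)
    have rest: "(\<Sum>l\<in>A - {k}. poly p (y l) * (\<Prod>m\<in>A - {l}. (x - y m) / (y l - y m))) = 0"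
      using zero by (intro sum.neutral) auto
    show "poly q x = poly p x"
      unfolding polyq sum.remove[OF assms(1) k(1)] one rest using k(2) by simp
  qed (use deg assms in \<open>auto simp: card_image\<close>)
  then show ?thesis using polyq[of z] by simp
qed

text \<open>The Garnir relation: the second factor is, as a polynomial in \<open>g k\<close>, of degree less than \<open>card A\<close>.\<close>

lemma vander_garnir:
  assumes "finite A" "finite C" "k \<in> C" "A \<inter> C = {}" "inj_on g (A \<union> C)" "card C \<le> card A"
  shows "(\<Sum>l\<in>A. vander A (g \<circ> transpose l k) * vander C (g \<circ> transpose l k)) = vander A g * vander C g"
proof -
  define B where "B = C - {k}"
  have B: "finite B" "k \<notin> B" and C: "C = insert k B" using assms unfolding B_def by auto
  have kA: "k \<notin> A" using assms by auto
  define p where "p = Polynomial.smult ((\<Prod>m\<in>B. if m < k then 1 else - 1) * vander B g) (\<Prod>j\<in>B. [:- g j, 1:])"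
  have polyp: "poly p z = (\<Prod>m\<in>B. if m < k then 1 else - 1) * vander B g * (\<Prod>j\<in>B. z - g j)" for z
    unfolding p_def poly_smult poly_prod by simp
  have "degree (\<Prod>j\<in>B. [:- g j, 1:]) \<le> (\<Sum>j\<in>B. degree [:- g j, 1:])"
    using degree_prod_sum_le[of B "\<lambda>j. [:- g j, 1:]"] B(1) by (simp add: o_def)
  then have "degree (\<Prod>j\<in>B. [:- g j, 1:]) \<le> card B" by simp
  then have "degree p \<le> card B" unfolding p_def by (rule order_trans[OF degree_smult_le])
  then have deg: "degree p < card A" using assms(6) B unfolding C by simp
  \<comment> \<open>Seen from \<open>C\<close>, the transposition puts \<open>g l\<close> in the
    place of \<open>g k\<close>, so this factor is the value of \<open>p\<close> at the node
    \<open>g l\<close>; the factor of \<open>A\<close> supplies the basis polynomial.\<close>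
  have vC: "vander C (g \<circ> transpose l k) = poly p (g l)" if "l \<in> A" for l
  proof -
    have id: "(g \<circ> transpose l k) m = g m" if "m \<in> B" for m
      using that \<open>l \<in> A\<close> assms(4) B C by (auto simp: transpose_def)
    have "vander B (g \<circ> transpose l k) = vander B g" using id by (rule vander_cong)
    moreover have "(\<Prod>m\<in>B. a - (g \<circ> transpose l k) m) = (\<Prod>m\<in>B. a - g m)" for a
      using id by (intro prod.cong) auto
    ultimately show ?thesis unfolding C vander_insert[OF B] polyp by simp
  qed
  have "inj_on g A" using assms(5) by (rule inj_on_subset) auto
  have "(\<Sum>l\<in>A. vander A (g \<circ> transpose l k) * vander C (g \<circ> transpose l k)) =
      (\<Sum>l\<in>A. vander A g * (poly p (g l) * (\<Prod>m\<in>A - {l}. (g k - g m) / (g l - g m))))"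
    using vC vander_transpose_out[OF assms(1) _ kA \<open>inj_on g A\<close>] by (intro sum.cong) auto
  also have "\<dots> = vander A g * poly p (g k)"
    unfolding sum_distrib_left[symmetric] using lagrange_interpolation[OF assms(1) \<open>inj_on g A\<close> deg] by simp
  also have "poly p (g k) = vander C g" unfolding C vander_insert[OF B] polyp by simp
  finally show ?thesis .
qed

section \<open>Left and right translation on the symmetric group\<close>

lemma inj_comp_transpose:
  assumes "inj f"
  shows "f \<circ> transpose k l = transpose (f k) (f l) \<circ> f"
  using assms by (auto simp: fun_eq_iff transpose_def inj_eq)

lemma transpose_conj:
  "transpose i j \<circ> transpose k l = transpose (transpose i j k) (transpose i j l) \<circ> transpose i j"
  by (rule inj_comp_transpose) simp

lemma transpose_conj':
  "transpose k l \<circ> transpose i j = transpose i j \<circ> transpose (transpose i j k) (transpose i j l)"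
  using transpose_conj[of i j "transpose i j k" "transpose i j l"] by simp

interpretation left: transposition_action n "{\<sigma>. \<sigma> permutes {1..n}}" "\<lambda>i j \<sigma>. transpose i j \<circ> \<sigma>" for n
proof
  fix i j :: nat and x :: "nat \<Rightarrow> nat"
  show "transpose i j \<circ> x = transpose j i \<circ> x" by (simp add: transpose_commute)
  show "transpose i j \<circ> (transpose i j \<circ> x) = x" by (simp add: fun_eq_iff)
  fix k l show "transpose i j \<circ> (transpose k l \<circ> x) =
      transpose (transpose i j k) (transpose i j l) \<circ> (transpose i j \<circ> x)"
    unfolding o_assoc transpose_conj[of i j k l] ..
next
  fix i j x assume a: "i \<in> {1..n}" "j \<in> {1..n}" "x \<in> {\<sigma>. \<sigma> permutes {1..n}}"
  have "transpose i j permutes {1..n}" by (rule permutes_swap_id[OF a(1,2)])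
  then show "transpose i j \<circ> x \<in> {\<sigma>. \<sigma> permutes {1..n}}"
    using permutes_compose[of x "{1..n}" "transpose i j"] a(3) by simp
qed

interpretation right: transposition_action n "{\<sigma>. \<sigma> permutes {1..n}}" "\<lambda>i j \<sigma>. \<sigma> \<circ> transpose i j" for n
proof
  fix i j :: nat and x :: "nat \<Rightarrow> nat"
  show "x \<circ> transpose i j = x \<circ> transpose j i" by (simp add: transpose_commute)
  show "x \<circ> transpose i j \<circ> transpose i j = x" by (simp add: fun_eq_iff)
  fix k l show "x \<circ> transpose k l \<circ> transpose i j =
      x \<circ> transpose i j \<circ> transpose (transpose i j k) (transpose i j l)"
    unfolding comp_assoc transpose_conj'[of k l i j] ..
next
  fix i j x assume a: "i \<in> {1..n}" "j \<in> {1..n}" "x \<in> {\<sigma>. \<sigma> permutes {1..n}}"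
  have "transpose i j permutes {1..n}" by (rule permutes_swap_id[OF a(1,2)])
  then show "x \<circ> transpose i j \<in> {\<sigma>. \<sigma> permutes {1..n}}"
    using permutes_compose[of "transpose i j" "{1..n}" x] a(3) by simp
qed

section \<open>Specht polynomials\<close>

locale column_word =
  fixes xs :: "(nat \<times> nat) list"
  assumes growth: "growth xs" and sorted: "sorted_wrt column_less xs"
begin

definition box :: "nat \<Rightarrow> nat \<times> nat" where
  "box p = xs ! (p - 1)"

definition col :: "nat \<Rightarrow> nat set" where
  "col c = {p \<in> {1..length xs}. snd (box p) = c}"

text \<open>The variable of position \<open>p\<close> is the value \<open>g p\<close>. Composing
  \<open>g\<close> with a transposition on the right therefore exchanges two variables, which
  becomes right translation once \<open>g\<close> runs over permutations.\<close>

definition specht :: "(nat \<Rightarrow> real) \<Rightarrow> real" where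
  "specht g = (\<Prod>c\<in>snd ` set xs. vander (col c) g)"

lemma box_in: "p \<in> {1..length xs} \<Longrightarrow> box p \<in> set xs"
  unfolding box_def by auto

lemma box_inj: "p \<in> {1..length xs} \<Longrightarrow> q \<in> {1..length xs} \<Longrightarrow> box p = box q \<Longrightarrow> p = q"
  unfolding box_def using growth_distinct[OF growth] by (auto simp: nth_eq_iff_index_eq)

lemma box_surj:
  assumes "b \<in> set xs"
  obtains p where "p \<in> {1..length xs}" "box p = b"
proof -
  obtain i where "i < length xs" "xs ! i = b" using assms by (auto simp: in_set_conv_nth)
  then show ?thesis using that[of "Suc i"] unfolding box_def by auto
qed

lemma box_less:
  assumes "p \<in> {1..length xs}" "q \<in> {1..length xs}" "p < q"
  shows "column_less (box p) (box q)"
proof -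
  have "p - 1 < q - 1" "q - 1 < length xs" using assms by auto
  then show ?thesis unfolding box_def using sorted sorted_wrt_nth_less by blast
qed

lemma finite_col: "finite (col c)"
  unfolding col_def by simp

text \<open>Each box has its left neighbours in the diagram, so columns cannot grow to the right.
  The Garnir relation uses this to keep the degree below the number of nodes.\<close>

lemma card_col_antimono:
  assumes "c' \<le> c"
  shows "card (col c) \<le> card (col c')"
proof -
  have inj: "inj_on (fst \<circ> box) (col d)" for d
    unfolding col_def by (intro inj_onI box_inj) (auto simp: prod_eq_iff)
  have "(fst \<circ> box) ` col c \<subseteq> (fst \<circ> box) ` col c'"
  proof
    fix r assume "r \<in> (fst \<circ> box) ` col c"
    then have "(r, c) \<in> set xs" using box_in unfolding col_def by (auto simp: prod.collapse)
    then have "(r, c') \<in> set xs" using order_idealD[OF growth_order_ideal[OF growth]] assms by blast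
    then obtain p where "p \<in> {1..length xs}" "box p = (r, c')" using box_surj by blast
    then show "r \<in> (fst \<circ> box) ` col c'" unfolding col_def by force
  qed
  then have "card ((fst \<circ> box) ` col c) \<le> card ((fst \<circ> box) ` col c')"
    by (intro card_mono finite_imageI finite_col)
  then show ?thesis by (simp only: card_image[OF inj])
qed

text \<open>In the column reading word the earlier positions of a column are the boxes above, and
  with rows numbered from 0 the row index counts them.\<close>

lemma card_above:
  assumes "k \<in> {1..length xs}"
  shows "card {l \<in> col (snd (box k)). l < k} = fst (box k)"
proof -
  define S where "S = {l \<in> col (snd (box k)). l < k}"
  have S: "l \<in> {1..length xs}" "snd (box l) = snd (box k)" "l < k" if "l \<in> S" for l
    using that unfolding S_def col_def by auto
  have "inj_on (fst \<circ> box) S"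
    using S by (intro inj_onI box_inj) (auto simp: prod_eq_iff)
  moreover have "(fst \<circ> box) ` S = {..<fst (box k)}"
  proof (rule Set.set_eqI, rule iffI)
    fix r assume "r \<in> (fst \<circ> box) ` S"
    then obtain l where l: "l \<in> S" "r = fst (box l)" by auto
    then have "column_less (box l) (box k)" using box_less[OF S(1) assms S(3)] by blast
    then show "r \<in> {..<fst (box k)}" using S(2)[OF l(1)] l(2) unfolding column_less_def by auto
  next
    fix r assume r: "r \<in> {..<fst (box k)}"
    have "(fst (box k), snd (box k)) \<in> set xs" using box_in[OF assms] by simp
    then have "(r, snd (box k)) \<in> set xs"
      by (rule order_idealD[OF growth_order_ideal[OF growth]]) (use r in auto)
    then obtain l where l: "l \<in> {1..length xs}" "box l = (r, snd (box k))" using box_surj by blast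
    have "\<not> k < l" using box_less[OF assms l(1)] l(2) r unfolding column_less_def by auto
    moreover have "l \<noteq> k" using l(2) r by (metis fst_conv lessThan_iff less_irrefl)
    ultimately have "l \<in> S" using l unfolding S_def col_def by auto
    then show "r \<in> (fst \<circ> box) ` S" using l(2) by force
  qed
  ultimately show ?thesis unfolding S_def[symmetric] by (metis card_image card_lessThan)
qed

lemma specht_transpose_same:
  assumes "k \<in> col c" "l \<in> col c" "l \<noteq> k" "c \<in> snd ` set xs"
  shows "specht (g \<circ> transpose l k) = - specht g"
proof -
  have "vander (col d) (g \<circ> transpose l k) = vander (col d) g" if "d \<noteq> c" for d
    using that assms(1,2) by (intro vander_cong) (auto simp: col_def transpose_def)
  then have "(\<Prod>d\<in>snd ` set xs - {c}. vander (col d) (g \<circ> transpose l k)) =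
      (\<Prod>d\<in>snd ` set xs - {c}. vander (col d) g)"
    by (intro prod.cong) auto
  then show ?thesis
    using vander_transpose_in[OF finite_col assms(2,1,3), of g] assms(4)
    unfolding specht_def by (simp add: prod.remove[of "snd ` set xs" c])
qed

text \<open>Only the factors of columns \<open>c\<close> and \<open>c'\<close> change, and for these
  two \<open>vander_garnir\<close> applies with the values on the longer column \<open>c'\<close> as
  nodes.\<close>

lemma specht_transpose_column:
  assumes "k \<in> col c" "c' < c" "c \<in> snd ` set xs" "c' \<in> snd ` set xs" "inj_on g {1..length xs}"
  shows "(\<Sum>l\<in>col c'. specht (g \<circ> transpose l k)) = specht g"
proof -
  define R where "R = (\<Prod>d\<in>snd ` set xs - {c'} - {c}. vander (col d) g)"
  have split: "specht h = vander (col c') h * vander (col c) h *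
      (\<Prod>d\<in>snd ` set xs - {c'} - {c}. vander (col d) h)" for h
    unfolding specht_def using assms(2-4)
    by (simp add: prod.remove[of "snd ` set xs" c'] prod.remove[of "snd ` set xs - {c'}" c])
  have "(\<Prod>d\<in>snd ` set xs - {c'} - {c}. vander (col d) (g \<circ> transpose l k)) = R" if "l \<in> col c'" for l
    unfolding R_def using that assms(1)
    by (intro prod.cong vander_cong) (auto simp: col_def transpose_def)
  then have "(\<Sum>l\<in>col c'. specht (g \<circ> transpose l k)) =
      (\<Sum>l\<in>col c'. vander (col c') (g \<circ> transpose l k) * vander (col c) (g \<circ> transpose l k)) * R"
    unfolding sum_distrib_right by (intro sum.cong) (auto simp: split)
  also have "(\<Sum>l\<in>col c'. vander (col c') (g \<circ> transpose l k) * vander (col c) (g \<circ> transpose l k)) =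
      vander (col c') g * vander (col c) g"
  proof (rule vander_garnir[OF finite_col finite_col assms(1)])
    show "col c' \<inter> col c = {}" using assms(2) unfolding col_def by auto
    show "inj_on g (col c' \<union> col c)" using assms(5) by (rule inj_on_subset) (auto simp: col_def)
    show "card (col c) \<le> card (col c')" using card_col_antimono assms(2) by simp
  qed
  finally show ?thesis unfolding split[of g] R_def .
qed

text \<open>Each complete column to the left contributes 1 by the Garnir relation, each box above in
  the same column contributes -1 by antisymmetry. The total is column minus row, the
  content.\<close>

lemma specht_jucys_murphy:
  assumes "inj_on g {1..length xs}" "k \<in> {1..length xs}"
  shows "(\<Sum>l\<in>{1..<k}. specht (g \<circ> transpose l k)) = word_content xs k * specht g"
proof -
  obtain r c where rc: "box k = (r, c)" by (cases "box k")
  have k: "k \<in> col c" using assms(2) rc unfolding col_def by simp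
  have cols: "d \<in> snd ` set xs" if "d \<le> c" for d
    using order_idealD[OF growth_order_ideal[OF growth], of r c r d] box_in[OF assms(2)] rc that by force
  \<comment> \<open>Here the column reading order is essential: the positions before
    \<open>k\<close> consist of complete columns and the upper part of its own column. In another
    tableau a column could be cut, and the Garnir relation would not apply to the part.\<close>
  have split: "{1..<k} = (\<Union>d\<in>{..<c}. col d) \<union> {l \<in> col c. l < k}"
  proof (rule Set.set_eqI, rule iffI)
    fix l assume l: "l \<in> {1..<k}"
    then have "column_less (box l) (box k)" using assms(2) by (intro box_less) auto
    then have "snd (box l) \<le> c" using rc unfolding column_less_def by auto
    then show "l \<in> (\<Union>d\<in>{..<c}. col d) \<union> {l \<in> col c. l < k}"
      using l assms(2) unfolding col_def by (cases "snd (box l) = c") auto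
  next
    fix l assume l: "l \<in> (\<Union>d\<in>{..<c}. col d) \<union> {l \<in> col c. l < k}"
    show "l \<in> {1..<k}"
    proof (cases "l \<in> col c")
      case True
      then show ?thesis using l unfolding col_def by auto
    next
      case False
      then have l': "l \<in> {1..length xs}" "snd (box l) < c" using l unfolding col_def by auto
      then have "\<not> k < l" "l \<noteq> k" using box_less[OF assms(2) l'(1)] rc unfolding column_less_def by auto
      then show ?thesis using l' by auto
    qed
  qed
  have "(\<Sum>l\<in>{1..<k}. specht (g \<circ> transpose l k)) =
      (\<Sum>l\<in>(\<Union>d\<in>{..<c}. col d). specht (g \<circ> transpose l k)) +
      (\<Sum>l\<in>{l \<in> col c. l < k}. specht (g \<circ> transpose l k))"
    unfolding split using finite_col by (intro sum.union_disjoint) (auto simp: col_def)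
  also have "(\<Sum>l\<in>(\<Union>d\<in>{..<c}. col d). specht (g \<circ> transpose l k)) =
      (\<Sum>d<c. \<Sum>l\<in>col d. specht (g \<circ> transpose l k))"
    using finite_col by (intro sum.UNION_disjoint) (auto simp: col_def)
  also have "\<dots> = (\<Sum>d<c. specht g)"
    using cols assms(1) k by (intro sum.cong specht_transpose_column) auto
  also have "(\<Sum>l\<in>{l \<in> col c. l < k}. specht (g \<circ> transpose l k)) = (\<Sum>l\<in>{l \<in> col c. l < k}. - specht g)"
    using k cols by (intro sum.cong specht_transpose_same) auto
  also have "(\<Sum>d<c. specht g) + \<dots> = (real c - real r) * specht g"
    using card_above[OF assms(2)] rc by (simp add: algebra_simps)
  finally show ?thesis using rc unfolding word_content_def content_of_def box_def by (simp add: o_def)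
qed

lemma specht_nonzero: "inj_on g {1..length xs} \<Longrightarrow> specht g \<noteq> 0"
proof -
  assume "inj_on g {1..length xs}"
  then have "inj_on g (col c)" for c by (rule inj_on_subset) (auto simp: col_def)
  then show ?thesis unfolding specht_def using vander_nonzero[OF finite_col] by auto
qed

text \<open>This is a diagonal matrix coefficient: the inner product of the Specht function with its
  own translate by \<open>\<sigma>\<close>. Passing to it gives a single function that is controlled
  under both translations.\<close>

definition two_sided :: "(nat \<Rightarrow> nat) \<Rightarrow> real" where
  "two_sided \<sigma> = (\<Sum>g | g permutes {1..length xs}. specht (real \<circ> (g \<circ> \<sigma>)) * specht (real \<circ> g))"

lemma specht_perm_jucys_murphy:
  assumes "g permutes {1..length xs}" "k \<in> {1..length xs}"
  shows "(\<Sum>l\<in>{1..<k}. specht (real \<circ> (g \<circ> transpose l k))) = word_content xs k * specht (real \<circ> g)"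
proof -
  have "inj_on (real \<circ> g) {1..length xs}" using permutes_inj_on[OF assms(1)] by (simp add: inj_on_def)
  from specht_jucys_murphy[OF this assms(2)] show ?thesis by (simp add: comp_assoc)
qed

lemma two_sided_right: "right.jm_eigen (length xs) (word_content xs) two_sided"
  unfolding right.jm_eigen_def
proof (intro ballI)
  fix k \<sigma> assume k: "k \<in> {1..length xs}" and \<sigma>: "\<sigma> \<in> {\<sigma>. \<sigma> permutes {1..length xs}}"
  have "(\<Sum>i\<in>{1..<k}. two_sided (\<sigma> \<circ> transpose i k)) =
      (\<Sum>g | g permutes {1..length xs}.
        (\<Sum>i\<in>{1..<k}. specht (real \<circ> (g \<circ> \<sigma> \<circ> transpose i k))) * specht (real \<circ> g))"
    unfolding two_sided_def sum_distrib_right by (subst sum.swap) (simp add: comp_assoc)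
  also have "\<dots> = (\<Sum>g | g permutes {1..length xs}.
        word_content xs k * specht (real \<circ> (g \<circ> \<sigma>)) * specht (real \<circ> g))"
    using \<sigma> k by (intro sum.cong refl arg_cong2[where f = "(*)"] specht_perm_jucys_murphy)
       (auto intro: permutes_compose)
  also have "\<dots> = word_content xs k * two_sided \<sigma>"
    unfolding two_sided_def by (simp add: sum_distrib_left mult.assoc)
  finally show "(\<Sum>i\<in>{1..<k}. two_sided (\<sigma> \<circ> transpose i k)) = word_content xs k * two_sided \<sigma>" .
qed

text \<open>Substituting \<open>g \<circ> transpose i k\<close> for \<open>g\<close> moves the
  transposition from \<open>\<sigma>\<close> to the second factor, where it acts from the right. So
  both sides reduce to the same eigenvector property of \<open>specht\<close>.\<close>

lemma two_sided_left: "left.jm_eigen (length xs) (word_content xs) two_sided"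
  unfolding left.jm_eigen_def
proof (intro ballI)
  fix k \<sigma> assume k: "k \<in> {1..length xs}"
  have "two_sided (transpose i k \<circ> \<sigma>) = (\<Sum>g | g permutes {1..length xs}.
      specht (real \<circ> (g \<circ> \<sigma>)) * specht (real \<circ> (g \<circ> transpose i k)))" if "i \<in> {1..<k}" for i
  proof -
    have t: "transpose i k permutes {1..length xs}" using that k by (intro permutes_swap_id) auto
    have "g \<circ> transpose i k \<circ> (transpose i k \<circ> \<sigma>) = g \<circ> \<sigma>" for g :: "nat \<Rightarrow> nat"
      by (simp add: fun_eq_iff)
    then show ?thesis
      unfolding two_sided_def
      by (subst sum_permutations_compose_right[OF t]) (simp add: o_def)
  qed
  then have "(\<Sum>i\<in>{1..<k}. two_sided (transpose i k \<circ> \<sigma>)) =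
      (\<Sum>g | g permutes {1..length xs}.
        specht (real \<circ> (g \<circ> \<sigma>)) * (\<Sum>i\<in>{1..<k}. specht (real \<circ> (g \<circ> transpose i k))))"
    unfolding sum_distrib_left by (subst sum.swap) simp
  also have "\<dots> = (\<Sum>g | g permutes {1..length xs}.
        specht (real \<circ> (g \<circ> \<sigma>)) * (word_content xs k * specht (real \<circ> g)))"
    using k by (intro sum.cong refl arg_cong2[where f = "(*)"] specht_perm_jucys_murphy) auto
  also have "\<dots> = word_content xs k * two_sided \<sigma>"
    unfolding two_sided_def by (simp add: sum_distrib_left algebra_simps)
  finally show "(\<Sum>i\<in>{1..<k}. two_sided (transpose i k \<circ> \<sigma>)) = word_content xs k * two_sided \<sigma>" .
qed

text \<open>At the identity the correlation is a sum of squares, each positive because a permutation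
  takes distinct values on the columns.\<close>

lemma two_sided_nonzero: "left.nonzero (length xs) two_sided"
proof -
  have "two_sided id > 0"
    unfolding two_sided_def
  proof (rule sum_pos)
    show "finite {g. g permutes {1..length xs}}" by (rule finite_permutations) simp
    show "{g. g permutes {1..length xs}} \<noteq> {}" using permutes_id by blast
    fix g assume "g \<in> {g. g permutes {1..length xs}}"
    then have "inj_on (real \<circ> g) {1..length xs}" by (auto simp: inj_on_def dest: permutes_inj injD)
    then show "specht (real \<circ> (g \<circ> id)) * specht (real \<circ> g) > 0"
      using specht_nonzero[of "real \<circ> g"] by (simp flip: power2_eq_square)
  qed
  then show ?thesis unfolding left.nonzero_def using permutes_id by (intro bexI[of _ id]) auto
qed

end

text \<open>Start from the correlation, which belongs to the pair of column reading words
  \<open>(zs, zs)\<close>. Moves from the left lead to \<open>(xs, zs)\<close>, then moves from the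
  right to \<open>(xs, ys)\<close>.\<close>

lemma joint_eigenvector_exists:
  assumes "growth xs" "growth ys" "set xs = set ys" "length xs = n"
  shows "\<exists>v. left.jm_eigen n (word_content xs) v \<and> right.jm_eigen n (word_content ys) v \<and>
    (\<exists>\<sigma>. \<sigma> permutes {1..n} \<and> v \<sigma> \<noteq> 0)"
proof -
  obtain zs where zs: "growth zs" "set zs = set xs" "sorted_wrt column_less zs"
    using column_growth_exists[of "set xs"] growth_order_ideal[OF assms(1)] by auto
  have len: "length zs = n" using length_growth zs(1,2) assms(1,4) by metis
  interpret column_word zs using zs by unfold_locales
  \<comment> \<open>Left and right translations commute by associativity, so a move on one side
    keeps the eigenvalue equations of the other. This and the mirror image \<open>comm_l\<close> are
    the invariants \<open>U\<close>.\<close>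
  have comm_r: "right.jm_eigen n c (\<lambda>\<sigma>. u (transpose k (Suc k) \<circ> \<sigma>) - a * u \<sigma>)"
    if u: "right.jm_eigen n c u" and k: "1 \<le> k" "k < n" for c u k a
    unfolding right.jm_eigen_def
  proof (intro ballI)
    fix j \<sigma> assume j: "j \<in> {1..n}" and \<sigma>: "\<sigma> \<in> {\<sigma>. \<sigma> permutes {1..n}}"
    have "transpose k (Suc k) \<circ> \<sigma> \<in> {\<sigma>. \<sigma> permutes {1..n}}"
      using \<sigma> k by (intro left.tr_closed) auto
    from right.jm_eigenD[OF u j this] right.jm_eigenD[OF u j \<sigma>]
    show "(\<Sum>i\<in>{1..<j}. u (transpose k (Suc k) \<circ> (\<sigma> \<circ> transpose i j)) - a * u (\<sigma> \<circ> transpose i j)) =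
        c j * (u (transpose k (Suc k) \<circ> \<sigma>) - a * u \<sigma>)"
      unfolding sum_subtractf sum_distrib_left[symmetric] comp_assoc by (simp add: algebra_simps)
  qed
  have comm_l: "left.jm_eigen n c (\<lambda>\<sigma>. u (\<sigma> \<circ> transpose k (Suc k)) - a * u \<sigma>)"
    if u: "left.jm_eigen n c u" and k: "1 \<le> k" "k < n" for c u k a
    unfolding left.jm_eigen_def
  proof (intro ballI)
    fix j \<sigma> assume j: "j \<in> {1..n}" and \<sigma>: "\<sigma> \<in> {\<sigma>. \<sigma> permutes {1..n}}"
    have "\<sigma> \<circ> transpose k (Suc k) \<in> {\<sigma>. \<sigma> permutes {1..n}}"
      using \<sigma> k by (intro right.tr_closed) auto
    from left.jm_eigenD[OF u j this] left.jm_eigenD[OF u j \<sigma>]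
    show "(\<Sum>i\<in>{1..<j}. u (transpose i j \<circ> \<sigma> \<circ> transpose k (Suc k)) - a * u (transpose i j \<circ> \<sigma>)) =
        c j * (u (\<sigma> \<circ> transpose k (Suc k)) - a * u \<sigma>)"
      unfolding sum_subtractf sum_distrib_left[symmetric] comp_assoc by (simp add: algebra_simps)
  qed
  have "\<exists>w. left.jm_eigen n (word_content xs) w \<and> left.nonzero n w \<and> right.jm_eigen n (word_content zs) w"
    using left.jm_eigen_growth_steps[where U = "right.jm_eigen n (word_content zs)",
        OF growth_connected[OF zs(1) assms(1) zs(2)] len _ _ _ comm_r]
      two_sided_left two_sided_right two_sided_nonzero len by blast
  then obtain w where w: "left.jm_eigen n (word_content xs) w" "left.nonzero n w"
    "right.jm_eigen n (word_content zs) w" by blast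
  have nz: "right.nonzero n w" using w(2) unfolding left.nonzero_def right.nonzero_def .
  have "set zs = set ys" using zs(2) assms(3) by simp
  then have "\<exists>v. right.jm_eigen n (word_content ys) v \<and> right.nonzero n v \<and> left.jm_eigen n (word_content xs) v"
    using right.jm_eigen_growth_steps[where U = "left.jm_eigen n (word_content xs)",
        OF growth_connected[OF zs(1) assms(2)] len w(3) nz w(1) comm_l] by blast
  then show ?thesis unfolding right.nonzero_def by blast
qed

section \<open>Cycle counts\<close>

text \<open>Where \<open>q\<close> goes from y to \<open>b\<close>, the new permutation goes from y
  to \<open>m\<close> and then to \<open>b\<close>; elsewhere on \<open>S\<close> they agree. So
  \<open>m\<close>, a fixed point of \<open>q\<close>, is spliced into the cycle of \<open>b\<close>
  and no other cycle changes.\<close>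

lemma orbit_transpose_comp:
  assumes q: "q permutes S" and m: "m \<notin> S" and b: "b \<in> S" and x: "x \<in> S"
  shows "orbit (transpose m b \<circ> q) x = (if b \<in> orbit q x then insert m (orbit q x) else orbit q x)"
    (is "orbit ?p x = ?h")
proof -
  have qm: "q m = m" using q m by (auto simp: permutes_def)
  have oS: "orbit q x \<subseteq> S" using permutes_orbit_subset[OF q x] .
  have p1: "?p y = q y" if "y \<in> S" "q y \<noteq> b" for y
  proof -
    have "q y \<in> S" using that permutes_in_image[OF q] by simp
    then show ?thesis using that m by (auto simp: transpose_def)
  qed
  have p2: "?p y = m" if "q y = b" for y using that by (auto simp: transpose_def)
  have p3: "?p m = b" using qm by (auto simp: transpose_def)
  have sub: "orbit ?p x \<subseteq> ?h"
  proof
    fix y assume "y \<in> orbit ?p x"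
    then show "y \<in> ?h"
    proof induction
      case base
      show ?case using p1[OF x] p2[of x] orbit.base[of q x] by (cases "q x = b") auto
    next
      case (step y)
      show ?case
      proof (cases "y = m")
        case True
        then show ?thesis using step.IH p3 oS m by (auto split: if_splits)
      next
        case False
        then have y: "y \<in> orbit q x" using step.IH by (auto split: if_splits)
        then have "q y \<in> orbit q x" by (rule orbit.step)
        then show ?thesis using p1[of y] p2[of y] y oS by (cases "q y = b") auto
      qed
    qed
  qed
  have reach: "q y \<in> orbit ?p x \<and> (q y = b \<longrightarrow> m \<in> orbit ?p x)"
    if "y \<in> S" "?p y \<in> orbit ?p x" for y
  proof (cases "q y = b")
    case True
    then have "m \<in> orbit ?p x" using that p2[OF True] by simp
    moreover from orbit.step[OF this] have "b \<in> orbit ?p x" using p3 by simp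
    ultimately show ?thesis using True by simp
  next
    case False
    then show ?thesis using that p1 by simp
  qed
  have "y \<in> orbit ?p x \<and> (y = b \<longrightarrow> m \<in> orbit ?p x)" if "y \<in> orbit q x" for y
    using that
  proof induction
    case base
    show ?case using reach[OF x orbit.base] .
  next
    case (step y)
    then have "y \<in> S" using oS by auto
    then show ?case using reach[OF _ orbit.step] step.IH by blast
  qed
  then have "?h \<subseteq> orbit ?p x" by auto
  with sub show ?thesis by blast
qed

text \<open>The step of the Chinese restaurant process: the new element either joins the cycle of an
  old \<open>b\<close>, or, for \<open>b = Suc n\<close>, where the transposition is the identity,
  opens a cycle of its own.\<close>

lemma cycle_count_transpose_comp:
  assumes q: "q permutes {1..n}" and b: "b \<in> {1..Suc n}"
  shows "cycle_count (Suc n) (transpose (Suc n) b \<circ> q) = cycle_count n q + (if b = Suc n then 1 else 0)"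
proof (cases "b = Suc n")
  case True
  have "q (Suc n) = Suc n" using q by (auto simp: permutes_def)
  then have "orbit q (Suc n) = {Suc n}" by (simp add: orbit_eq_singleton_iff)
  moreover have "{Suc n} \<notin> orbit q ` {1..n}"
    using permutes_orbit_subset[OF q] by force
  moreover have "{1..Suc n} = insert (Suc n) {1..n}" by auto
  ultimately show ?thesis using True unfolding cycle_count_def by simp
next
  case False
  then have b: "b \<in> {1..n}" using assms(2) by auto
  define p where "p = transpose (Suc n) b \<circ> q"
  \<comment> \<open>The effect on the cycles as sets. Deleting \<open>Suc n\<close> undoes it, so
    distinct cycles stay distinct.\<close>
  define h where "h C = (if b \<in> C then insert (Suc n) C else C)" for C
  have orb: "orbit p x = h (orbit q x)" if "x \<in> {1..n}" for x
    unfolding p_def h_def using that b q by (intro orbit_transpose_comp) auto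
  have "q (Suc n) = Suc n" using q by (auto simp: permutes_def)
  then have pb: "p (Suc n) = b" unfolding p_def by (simp add: transpose_def)
  have perm: "permutation p"
    unfolding p_def using q by (intro permutation_compose permutation_swap_id) (auto simp: permutation_permutes)
  have "orbit p (p (Suc n)) = orbit p (Suc n)"
    using permutation_orbit_step[OF perm] .
  then have "orbit p (Suc n) = orbit p b" using pb by simp
  moreover have "{1..Suc n} = insert (Suc n) {1..n}" by auto
  ultimately have "orbit p ` {1..Suc n} = orbit p ` {1..n}" using b by auto
  also have "\<dots> = h ` orbit q ` {1..n}" using orb by (auto simp: image_iff)
  finally have "cycle_count (Suc n) p = card (h ` orbit q ` {1..n})" unfolding cycle_count_def by simp
  also have "inj_on h (orbit q ` {1..n})"
  proof (rule inj_on_inverseI[where g = "\<lambda>C. C - {Suc n}"])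
    fix C assume "C \<in> orbit q ` {1..n}"
    then have "C \<subseteq> {1..n}" using permutes_orbit_subset[OF q] by blast
    then have "Suc n \<notin> C" by auto
    then show "h C - {Suc n} = C" unfolding h_def by auto
  qed
  then have "card (h ` orbit q ` {1..n}) = cycle_count n q"
    unfolding cycle_count_def by (rule card_image)
  finally show ?thesis using False unfolding p_def by simp
qed

text \<open>Jucys' factorisation of the sum of all \<open>\<theta> ^ cycle_count n \<pi>\<close> times \<open>\<pi>\<close> into the factors
  \<open>\<theta> + J\<^sub>k\<close>, evaluated on a joint eigenvector.\<close>

lemma sum_cycle_count_eigen:
  assumes eig: "left.jm_eigen n c v" and \<sigma>: "\<sigma> permutes {1..n}" and "m \<le> n"
  shows "(\<Sum>\<pi> | \<pi> permutes {1..m}. \<theta> ^ cycle_count m \<pi> * v (\<pi> \<circ> \<sigma>)) = (\<Prod>k=1..m. \<theta> + c k) * v \<sigma>"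
  using assms(3)
proof (induction m)
  case 0
  have "{\<pi>. \<pi> permutes {1..0::nat}} = {id}" by auto
  then show ?case by (simp add: cycle_count_def)
next
  case (Suc m)
  have ins: "{1..Suc m} = insert (Suc m) {1..m}" by auto
  have "(\<Sum>\<pi> | \<pi> permutes {1..Suc m}. \<theta> ^ cycle_count (Suc m) \<pi> * v (\<pi> \<circ> \<sigma>)) =
      (\<Sum>b\<in>{1..Suc m}. \<Sum>q | q permutes {1..m}.
        \<theta> ^ cycle_count (Suc m) (transpose (Suc m) b \<circ> q) * v (transpose (Suc m) b \<circ> q \<circ> \<sigma>))"
    unfolding ins by (rule sum_over_permutations_insert) auto
  also have "\<dots> = (\<Sum>q | q permutes {1..m}. \<Sum>b\<in>{1..Suc m}.
        \<theta> ^ cycle_count (Suc m) (transpose (Suc m) b \<circ> q) * v (transpose (Suc m) b \<circ> q \<circ> \<sigma>))"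
    by (rule sum.swap)
  also have "\<dots> = (\<Sum>q | q permutes {1..m}. (\<theta> + c (Suc m)) * (\<theta> ^ cycle_count m q * v (q \<circ> \<sigma>)))"
  proof (rule sum.cong[OF refl])
    fix q assume "q \<in> {q. q permutes {1..m}}"
    then have q: "q permutes {1..m}" by simp
    then have "q permutes {1..n}" by (rule permutes_subset) (use Suc.prems in auto)
    \<comment> \<open>The eigenvalue equation for J_{m+1} is applied at
      \<open>q \<circ> \<sigma>\<close>, where the new transposition is the outermost factor. What
      remains is a multiple of the sum for \<open>m\<close> at the same
      \<open>\<sigma>\<close>.\<close>
    then have q\<sigma>: "q \<circ> \<sigma> \<in> {\<sigma>. \<sigma> permutes {1..n}}" using \<sigma> by (auto intro: permutes_compose)
    have cc: "cycle_count (Suc m) (transpose (Suc m) b \<circ> q) = cycle_count m q" if "b \<in> {1..m}" for b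
      using cycle_count_transpose_comp[OF q, of b] that by auto
    have "(\<Sum>b\<in>{1..Suc m}. \<theta> ^ cycle_count (Suc m) (transpose (Suc m) b \<circ> q) *
          v (transpose (Suc m) b \<circ> q \<circ> \<sigma>)) =
        \<theta> ^ Suc (cycle_count m q) * v (q \<circ> \<sigma>) +
        (\<Sum>b\<in>{1..m}. \<theta> ^ cycle_count m q * v (transpose b (Suc m) \<circ> (q \<circ> \<sigma>)))"
      unfolding ins using cc cycle_count_transpose_comp[OF q, of "Suc m"]
      by (simp add: comp_assoc transpose_commute)
    also have "(\<Sum>b\<in>{1..m}. \<theta> ^ cycle_count m q * v (transpose b (Suc m) \<circ> (q \<circ> \<sigma>))) =
        \<theta> ^ cycle_count m q * (c (Suc m) * v (q \<circ> \<sigma>))"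
      unfolding sum_distrib_left[symmetric]
      using left.jm_eigenD[OF eig _ q\<sigma>, of "Suc m"] Suc.prems by (simp add: atLeastLessThanSuc_atLeastAtMost)
    finally show "(\<Sum>b\<in>{1..Suc m}. \<theta> ^ cycle_count (Suc m) (transpose (Suc m) b \<circ> q) *
          v (transpose (Suc m) b \<circ> q \<circ> \<sigma>)) =
        (\<theta> + c (Suc m)) * (\<theta> ^ cycle_count m q * v (q \<circ> \<sigma>))"
      by (simp add: algebra_simps o_def)
  qed
  also have "\<dots> = (\<Prod>k=1..Suc m. \<theta> + c k) * v \<sigma>"
    unfolding sum_distrib_left[symmetric] Suc.IH[OF Suc_leD[OF Suc.prems]] by (simp add: algebra_simps)
  finally show ?case .
qed

section \<open>Diagonalisation\<close>

text \<open>The operators enter only through \<open>closed\<close>: applying one to a vanishing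
  combination gives a vanishing combination. So they need not be defined as linear maps, and the
  functions matter only on \<open>X\<close>.\<close>

lemma eigen_independent:
  fixes a :: "'i \<Rightarrow> real" and v :: "'i \<Rightarrow> 'x \<Rightarrow> real" and lam :: "'k \<Rightarrow> 'i \<Rightarrow> real"
  assumes "finite I"
    and sep: "\<And>p q. p \<in> I \<Longrightarrow> q \<in> I \<Longrightarrow> p \<noteq> q \<Longrightarrow> \<exists>k\<in>K. lam k p \<noteq> lam k q"
    and nz: "\<And>p. p \<in> I \<Longrightarrow> \<exists>x\<in>X. v p x \<noteq> 0"
    and closed: "\<And>a k. k \<in> K \<Longrightarrow> \<forall>x\<in>X. (\<Sum>p\<in>I. a p * v p x) = 0 \<Longrightarrow>
      \<forall>x\<in>X. (\<Sum>p\<in>I. a p * (lam k p * v p x)) = 0"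
    and "\<forall>x\<in>X. (\<Sum>p\<in>I. a p * v p x) = 0"
  shows "\<forall>p\<in>I. a p = 0"
  using assms(5)
proof (induction "card {p \<in> I. a p \<noteq> 0}" arbitrary: a rule: less_induct)
  case less
  show ?case
  proof (rule ccontr)
    assume "\<not> (\<forall>p\<in>I. a p = 0)"
    then obtain p where p: "p \<in> I" "a p \<noteq> 0" by blast
    have others: "a q = 0" if q: "q \<in> I" "q \<noteq> p" for q
    proof -
      obtain k where k: "k \<in> K" "lam k p \<noteq> lam k q" using sep p q by metis
      \<comment> \<open>The relation after applying the operator \<open>k\<close> minus
        \<open>lam k p\<close> times the relation itself. Its support has lost \<open>p\<close> and
        gained nothing, so by induction it is trivial, while the factor at \<open>q\<close> is
        nonzero.\<close>
      define b where "b r = a r * (lam k r - lam k p)" for r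
      have "(\<Sum>r\<in>I. b r * v r x) = 0" if "x \<in> X" for x
      proof -
        have "(\<Sum>r\<in>I. b r * v r x) =
            (\<Sum>r\<in>I. a r * (lam k r * v r x)) - lam k p * (\<Sum>r\<in>I. a r * v r x)"
          unfolding b_def by (simp add: sum_distrib_left sum_subtractf algebra_simps)
        then show ?thesis using closed[OF k(1) less.prems] less.prems that by simp
      qed
      moreover have "card {r \<in> I. b r \<noteq> 0} < card {r \<in> I. a r \<noteq> 0}"
        using assms(1) p by (intro psubset_card_mono) (auto simp: b_def)
      ultimately have "b q = 0" using less.hyps[of b] q by blast
      then show ?thesis using k unfolding b_def by simp
    qed
    obtain x where x: "x \<in> X" "v p x \<noteq> 0" using nz p by blast
    have "(\<Sum>r\<in>I. a r * v r x) = a p * v p x"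
      using sum.remove[OF assms(1) p(1), of "\<lambda>r. a r * v r x"] others by simp
    then show False using less.prems x p by auto
  qed
qed

definition growth_pairs :: "nat \<Rightarrow> ((nat \<times> nat) list \<times> (nat \<times> nat) list) set" where
  "growth_pairs n = {(xs, ys). growth xs \<and> growth ys \<and> set xs = set ys \<and> length xs = n}"

lemma growth_pairs_Sigma:
  "growth_pairs n = (\<Union>D\<in>ideals n. {xs. growth xs \<and> set xs = D} \<times> {xs. growth xs \<and> set xs = D})"
  unfolding growth_pairs_def ideals_def using growth_order_ideal length_growth by auto

lemma finite_growth_pairs: "finite (growth_pairs n)"
  unfolding growth_pairs_Sigma by (intro finite_UN_I finite_ideals finite_cartesian_product finite_growths)
    (auto simp: ideals_def)

text \<open>With \<open>Q\<close> constantly true this is the dimension count; with \<open>Q\<close>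
  selecting the shapes of a given eigenvalue it is the multiplicity.\<close>

lemma card_growth_pairs_filter:
  "card {p \<in> growth_pairs n. Q (set (fst p))} = (\<Sum>D | D \<in> ideals n \<and> Q D. (growth_count D)\<^sup>2)"
proof -
  have "{p \<in> growth_pairs n. Q (set (fst p))} =
      (\<Union>D\<in>{D \<in> ideals n. Q D}. {xs. growth xs \<and> set xs = D} \<times> {xs. growth xs \<and> set xs = D})"
    unfolding growth_pairs_Sigma by auto
  also have "card \<dots> = (\<Sum>D | D \<in> ideals n \<and> Q D.
      card ({xs. growth xs \<and> set xs = D} \<times> {xs. growth xs \<and> set xs = D}))"
  proof (rule card_UN_disjoint)
    show "finite {D \<in> ideals n. Q D}" using finite_ideals[of n] by simp
  qed (auto simp: ideals_def intro!: finite_cartesian_product finite_growths)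
  also have "\<dots> = (\<Sum>D | D \<in> ideals n \<and> Q D. (growth_count D)\<^sup>2)"
    unfolding growth_count_def by (simp add: card_cartesian_product power2_eq_square)
  finally show ?thesis .
qed

lemma card_growth_pairs: "card (growth_pairs n) = fact n"
  using card_growth_pairs_filter[of n "\<lambda>_. True"] sum_growth_count_squares[of n] by simp

definition ideal_eigenvalue :: "nat \<Rightarrow> real \<Rightarrow> (nat \<times> nat) set \<Rightarrow> real" where
  "ideal_eigenvalue n \<theta> D = (\<Prod>b\<in>D. \<theta> + real_of_int (content_of b)) / pochhammer \<theta> n"

lemma prod_word_content:
  assumes "distinct xs"
  shows "(\<Prod>k=1..length xs. \<theta> + word_content xs k) = (\<Prod>b\<in>set xs. \<theta> + real_of_int (content_of b))"
proof -
  have "bij_betw (\<lambda>k. k - 1) {1..length xs} {..<length xs}"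
    by (rule bij_betw_byWitness[where f' = Suc]) auto
  from bij_betw_trans[OF this bij_betw_nth[OF assms refl refl]]
  have "bij_betw (\<lambda>k. xs ! (k - 1)) {1..length xs} (set xs)" by (simp add: o_def)
  then show ?thesis
    using prod.reindex_bij_betw[of "\<lambda>k. xs ! (k - 1)" "{1..length xs}" "set xs" "\<lambda>b. \<theta> + real_of_int (content_of b)"]
    unfolding word_content_def by simp
qed

lemma joint_eigenvectors_independent:
  assumes eig: "\<And>p. p \<in> growth_pairs n \<Longrightarrow> left.jm_eigen n (word_content (fst p)) (v p) \<and>
      right.jm_eigen n (word_content (snd p)) (v p) \<and> (\<exists>\<sigma>. \<sigma> permutes {1..n} \<and> v p \<sigma> \<noteq> 0)"
    and zero: "\<forall>\<sigma>\<in>{\<sigma>. \<sigma> permutes {1..n}}. (\<Sum>p\<in>growth_pairs n. a p * v p \<sigma>) = 0"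
  shows "\<forall>p\<in>growth_pairs n. a p = 0"
proof -
  \<comment> \<open>An index consists of a side, true for left, and the number of a Jucys-Murphy
    element. The left ones see the first tableau of the pair, the right ones the second.\<close>
  define lam where "lam s p = word_content (if fst s then fst p else snd p) (snd s)"
    for s :: "bool \<times> nat" and p :: "(nat \<times> nat) list \<times> (nat \<times> nat) list"
  show ?thesis
  proof (rule eigen_independent[where K = "UNIV \<times> {1..n}" and lam = lam, OF finite_growth_pairs _ _ _ zero])
    fix p q assume pq: "p \<in> growth_pairs n" "q \<in> growth_pairs n" "p \<noteq> q"
    show "\<exists>s\<in>UNIV \<times> {1..n}. lam s p \<noteq> lam s q"
    proof (rule ccontr)
      assume neg: "\<not> ?thesis"
      have eq: "xs = ys" if "growth xs" "growth ys" "length xs = n" "length ys = n"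
        "\<And>k. k \<in> {1..n} \<Longrightarrow> word_content xs k = word_content ys k" for xs ys
      proof (rule growth_eq_contents[OF that(1,2)], rule nth_equalityI)
        fix i assume "i < length (map content_of xs)"
        then show "map content_of xs ! i = map content_of ys ! i"
          using that(5)[of "Suc i"] that(3,4) unfolding word_content_def by simp
      qed (use that in simp)
      have g: "growth (fst r)" "growth (snd r)" "length (fst r) = n" "length (snd r) = n"
        if "r \<in> growth_pairs n" for r
        using that length_growth[of "fst r"] length_growth[of "snd r"] unfolding growth_pairs_def
        by (auto simp: case_prod_unfold)
      have "lam (s, k) p = lam (s, k) q" if "k \<in> {1..n}" for s k using neg that by auto
      from this[of _ True] this[of _ False]
      have "word_content (fst p) k = word_content (fst q) k" "word_content (snd p) k = word_content (snd q) k"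
        if "k \<in> {1..n}" for k using that unfolding lam_def by simp_all
      then have "fst p = fst q" "snd p = snd q"
        using eq[of "fst p" "fst q"] eq[of "snd p" "snd q"] g[OF pq(1)] g[OF pq(2)] by blast+
      then show False using pq by (simp add: prod_eq_iff)
    qed
  next
    fix p assume "p \<in> growth_pairs n"
    then show "\<exists>\<sigma>\<in>{\<sigma>. \<sigma> permutes {1..n}}. v p \<sigma> \<noteq> 0" using eig by blast
  next
    fix b s assume s: "s \<in> (UNIV :: bool set) \<times> {1..n}"
      and b: "\<forall>\<sigma>\<in>{\<sigma>. \<sigma> permutes {1..n}}. (\<Sum>p\<in>growth_pairs n. b p * v p \<sigma>) = 0"
    show "\<forall>\<sigma>\<in>{\<sigma>. \<sigma> permutes {1..n}}. (\<Sum>p\<in>growth_pairs n. b p * (lam s p * v p \<sigma>)) = 0"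
    proof
      fix \<sigma> assume \<sigma>: "\<sigma> \<in> {\<sigma>. \<sigma> permutes {1..n}}"
      obtain e k where sk: "s = (e, k)" and k: "k \<in> {1..n}" using s by auto
      define t where "t i = (if e then transpose i k \<circ> \<sigma> else \<sigma> \<circ> transpose i k)" for i
      have t: "t i \<in> {\<sigma>. \<sigma> permutes {1..n}}" if "i \<in> {1..<k}" for i
        unfolding t_def using left.tr_closed[of i n k \<sigma>] right.tr_closed[of i n k \<sigma>] that k \<sigma> by simp
      have "lam s p * v p \<sigma> = (\<Sum>i\<in>{1..<k}. v p (t i))" if "p \<in> growth_pairs n" for p
        using left.jm_eigenD[of n "word_content (fst p)" "v p", OF _ k \<sigma>]
          right.jm_eigenD[of n "word_content (snd p)" "v p", OF _ k \<sigma>] eig[OF that]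
        unfolding lam_def t_def sk by simp
      then have "(\<Sum>p\<in>growth_pairs n. b p * (lam s p * v p \<sigma>)) =
          (\<Sum>p\<in>growth_pairs n. b p * (\<Sum>i\<in>{1..<k}. v p (t i)))"
        by (intro sum.cong) auto
      also have "\<dots> = (\<Sum>i\<in>{1..<k}. \<Sum>p\<in>growth_pairs n. b p * v p (t i))"
        unfolding sum_distrib_left by (rule sum.swap)
      also have "\<dots> = 0" using b t by (intro sum.neutral) blast
      finally show "(\<Sum>p\<in>growth_pairs n. b p * (lam s p * v p \<sigma>)) = 0" .
    qed
  qed
qed

section \<open>From eigenvectors to the characteristic polynomial\<close>

lemma char_poly_diagonalised:
  fixes A Q :: "real mat"
  assumes A: "A \<in> carrier_mat N N" and Q: "Q \<in> carrier_mat N N"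
    and AQ: "\<And>i j. i < N \<Longrightarrow> j < N \<Longrightarrow> (\<Sum>k<N. A $$ (i, k) * Q $$ (k, j)) = d j * Q $$ (i, j)"
    and indep: "\<And>a. \<forall>i<N. (\<Sum>j<N. Q $$ (i, j) * a j) = 0 \<Longrightarrow> \<forall>j<N. a j = 0"
  shows "char_poly A = (\<Prod>j\<leftarrow>[0..<N]. [:- d j, 1:])"
proof -
  define B where "B = mat N N (\<lambda>(i, j). if i = j then d j else 0)"
  have B: "B \<in> carrier_mat N N" unfolding B_def by simp
  have "det Q \<noteq> 0"
  proof
    assume "det Q = 0"
    then obtain u where u: "u \<in> carrier_vec N" "u \<noteq> 0\<^sub>v N" "Q *\<^sub>v u = 0\<^sub>v N"
      using det_0_iff_vec_prod_zero[OF Q] by blast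
    have "(\<Sum>j<N. Q $$ (i, j) * u $ j) = 0" if "i < N" for i
    proof -
      have "(Q *\<^sub>v u) $ i = (\<Sum>j<N. Q $$ (i, j) * u $ j)"
        using that Q u(1) by (auto simp: scalar_prod_def atLeast0LessThan intro!: sum.cong)
      then show ?thesis using u(3) that by simp
    qed
    then have "\<forall>j<N. u $ j = 0" using indep by blast
    then have "u = 0\<^sub>v N" using u(1) by (intro eq_vecI) auto
    then show False using u(2) by simp
  qed
  then have "Q \<in> Units (ring_mat TYPE(real) N ())" by (rule det_non_zero_imp_unit[OF Q])
  then obtain R where R: "R \<in> carrier_mat N N" "Q * R = 1\<^sub>m N" "R * Q = 1\<^sub>m N"
    unfolding Units_def ring_mat_def by auto
  have "A * Q = Q * B"
  proof (rule eq_matI)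
    fix i j assume "i < dim_row (Q * B)" "j < dim_col (Q * B)"
    then have ij: "i < N" "j < N" using Q B by auto
    have "(A * Q) $$ (i, j) = d j * Q $$ (i, j)"
      using ij A Q AQ[OF ij] by (simp add: scalar_prod_def atLeast0LessThan)
    also have "\<dots> = (\<Sum>k<N. if k = j then Q $$ (i, k) * d j else 0)" using ij by simp
    also have "\<dots> = (Q * B) $$ (i, j)"
      using ij Q unfolding B_def
      by (simp add: scalar_prod_def atLeast0LessThan if_distrib[where f = "(*) _"] cong: if_cong)
    finally show "(A * Q) $$ (i, j) = (Q * B) $$ (i, j)" .
  qed (use A Q B in auto)
  then have "Q * B * R = A * (Q * R)" using assoc_mult_mat[OF A Q R(1)] by simp
  then have "A = Q * B * R" using A R by simp
  then have "similar_mat A B" using A B Q R by (intro similar_matI[of _ _ Q R N]) auto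
  then have "char_poly A = char_poly B" by (rule char_poly_similar)
  also have "\<dots> = (\<Prod>a\<leftarrow>diag_mat B. [:- a, 1:])"
    using B by (rule char_poly_upper_triangular) (auto simp: upper_triangular_def B_def)
  also have "diag_mat B = map d [0..<N]" unfolding diag_mat_def B_def by (auto intro!: nth_equalityI)
  finally show ?thesis by (simp add: o_def)
qed

text \<open>The enumeration \<open>h\<close> of pairs has length n!, so the matrix of eigenvectors
  is square. The eigenvalue depends only on the shape of the pair, hence each shape contributes as
  often as it has pairs of tableaux.\<close>

lemma char_poly_transition_matrix:
  assumes e: "bij_betw e {..<fact n} {\<sigma>. \<sigma> permutes {1..n}}"
    and h: "bij_betw h {..<fact n} (growth_pairs n)"
  shows "char_poly (transition_matrix n \<theta> e) =
    (\<Prod>j\<leftarrow>[0..<fact n]. [:- ideal_eigenvalue n \<theta> (set (fst (h j))), 1:])"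
proof -
  let ?S = "{\<sigma>. \<sigma> permutes {1..n}}"
  have "\<exists>v. \<forall>p\<in>growth_pairs n. left.jm_eigen n (word_content (fst p)) (v p) \<and>
      right.jm_eigen n (word_content (snd p)) (v p) \<and> (\<exists>\<sigma>. \<sigma> permutes {1..n} \<and> v p \<sigma> \<noteq> 0)"
  proof (rule bchoice, rule ballI)
    fix p assume "p \<in> growth_pairs n"
    then show "\<exists>v. left.jm_eigen n (word_content (fst p)) v \<and>
        right.jm_eigen n (word_content (snd p)) v \<and> (\<exists>\<sigma>. \<sigma> permutes {1..n} \<and> v \<sigma> \<noteq> 0)"
      unfolding growth_pairs_def by (intro joint_eigenvector_exists) (auto simp: case_prod_unfold)
  qed
  then obtain v where v: "\<And>p. p \<in> growth_pairs n \<Longrightarrow> left.jm_eigen n (word_content (fst p)) (v p) \<and>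
      right.jm_eigen n (word_content (snd p)) (v p) \<and> (\<exists>\<sigma>. \<sigma> permutes {1..n} \<and> v p \<sigma> \<noteq> 0)" by blast
  define Q where "Q = mat (fact n) (fact n) (\<lambda>(i, j). v (h j) (e i))"
  have hI: "h j \<in> growth_pairs n" if "j < fact n" for j using bij_betwE[OF h] that by blast
  have eS: "e i \<in> ?S" if "i < fact n" for i using bij_betwE[OF e] that by blast
  show ?thesis
  proof (rule char_poly_diagonalised[where Q = Q])
    show "transition_matrix n \<theta> e \<in> carrier_mat (fact n) (fact n)" "Q \<in> carrier_mat (fact n) (fact n)"
      unfolding transition_matrix_def Q_def by auto
  next
    fix i j :: nat assume ij: "i < fact n" "j < fact n"
    obtain xs ys where xy: "h j = (xs, ys)" by (cases "h j")
    then have xs: "growth xs" "length xs = n" using hI[OF ij(2)] unfolding growth_pairs_def by auto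
    have ei: "e i permutes {1..n}" using eS[OF ij(1)] by simp
    have "(\<Sum>k<fact n. transition_matrix n \<theta> e $$ (i, k) * Q $$ (k, j)) =
        (\<Sum>k<fact n. \<theta> ^ cycle_count n (e k \<circ> inv_into UNIV (e i)) / pochhammer \<theta> n * v (h j) (e k))"
      using ij unfolding transition_matrix_def Q_def by (intro sum.cong) auto
    also have "\<dots> = (\<Sum>\<tau>\<in>?S. \<theta> ^ cycle_count n (\<tau> \<circ> inv_into UNIV (e i)) / pochhammer \<theta> n * v (h j) \<tau>)"
      by (rule sum.reindex_bij_betw[OF e])
    also have "\<dots> = (\<Sum>\<pi>\<in>?S. \<theta> ^ cycle_count n \<pi> * v (h j) (\<pi> \<circ> e i)) / pochhammer \<theta> n"
    proof -
      \<comment> \<open>Substituting \<tau> = \<open>\<pi> \<circ> e i\<close> removes the starting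
        state from the exponent and puts it into the argument of the eigenvector.\<close>
      have "\<pi> \<circ> e i \<circ> inv_into UNIV (e i) = \<pi>" for \<pi> :: "nat \<Rightarrow> nat"
        using permutes_inv_o(1)[OF ei] by (simp add: comp_assoc)
      then show ?thesis
        by (subst sum_permutations_compose_right[OF ei]) (simp add: sum_divide_distrib)
    qed
    also have "\<dots> = ideal_eigenvalue n \<theta> (set (fst (h j))) * v (h j) (e i)"
      using sum_cycle_count_eigen[OF conjunct1[OF v[OF hI[OF ij(2)]]] ei order_refl, of \<theta>]
        prod_word_content[OF growth_distinct[OF xs(1)], of \<theta>] xs xy
      unfolding ideal_eigenvalue_def by simp
    also have "v (h j) (e i) = Q $$ (i, j)" using ij unfolding Q_def by simp
    finally show "(\<Sum>k<fact n. transition_matrix n \<theta> e $$ (i, k) * Q $$ (k, j)) =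
        ideal_eigenvalue n \<theta> (set (fst (h j))) * Q $$ (i, j)" .
  next
    fix a :: "nat \<Rightarrow> real" assume a: "\<forall>i<fact n. (\<Sum>j<fact n. Q $$ (i, j) * a j) = 0"
    define b where "b p = a (inv_into {..<fact n} h p)" for p
    have bh: "b (h j) = a j" if "j < fact n" for j
      unfolding b_def using bij_betw_inv_into_left[OF h] that by simp
    have "(\<Sum>p\<in>growth_pairs n. b p * v p \<sigma>) = 0" if "\<sigma> \<in> ?S" for \<sigma>
    proof -
      obtain i where i: "i < fact n" "\<sigma> = e i" using e \<open>\<sigma> \<in> ?S\<close> unfolding bij_betw_def by force
      have "(\<Sum>p\<in>growth_pairs n. b p * v p \<sigma>) = (\<Sum>j<fact n. b (h j) * v (h j) \<sigma>)"
        by (rule sum.reindex_bij_betw[OF h, symmetric])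
      also have "\<dots> = (\<Sum>j<fact n. Q $$ (i, j) * a j)"
        using i bh unfolding Q_def by (intro sum.cong) auto
      finally show ?thesis using a i by simp
    qed
    then have "\<forall>p\<in>growth_pairs n. b p = 0" using joint_eigenvectors_independent[OF v] by blast
    then show "\<forall>j<fact n. a j = 0" using bh hI by metis
  qed
qed

lemma order_prod_linear:
  fixes d :: "'i \<Rightarrow> 'a :: field"
  shows "Polynomial.order x (\<Prod>j\<leftarrow>js. [:- d j, 1:]) = length (filter (\<lambda>j. d j = x) js)"
proof (induction js)
  case (Cons j js)
  have "(\<Prod>j\<leftarrow>js. [:- d j, 1:]) \<noteq> 0" by (auto simp: prod_list_zero_iff)
  then have "[:- d j, 1:] * (\<Prod>j\<leftarrow>js. [:- d j, 1:]) \<noteq> 0" by (simp only: mult_eq_0_iff) simp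
  then show ?case using Cons by (simp add: order_mult order_linear' del: mult_pCons_left)
qed (simp add: order_1_eq_0)

lemma map_poly_prod_linear:
  "map_poly complex_of_real (\<Prod>j\<leftarrow>js. [:- d j, 1:]) = (\<Prod>j\<leftarrow>js. [:- complex_of_real (d j), 1:])"
proof -
  interpret map_poly_comm_ring_hom complex_of_real ..
  show ?thesis
    by (induction js) (simp_all add: hom_mult of_real_hom.map_poly_pCons_hom del: mult_pCons_left)
qed

section \<open>Partitions and standard tableaux\<close>

text \<open>The prefix of length k is the set of boxes with entries at most k. In this form growth
  words meet tableaux: entries increase along rows and columns exactly if all these sublevel sets
  are order ideals.\<close>

lemma growth_iff_prefixes:
  "growth xs \<longleftrightarrow> distinct xs \<and> (\<forall>k\<le>length xs. order_ideal (set (take k xs)))"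
proof (induction xs rule: rev_induct)
  case Nil
  then show ?case by (simp add: growth_Nil order_ideal_empty)
next
  case (snoc b xs)
  have "(\<forall>k\<le>length (xs @ [b]). order_ideal (set (take k (xs @ [b])))) \<longleftrightarrow>
      (\<forall>k\<le>length xs. order_ideal (set (take k xs))) \<and> order_ideal (insert b (set xs))"
    by (auto simp: le_Suc_eq)
  then show ?case using snoc by (auto simp: growth_snoc_iff)
qed

lemma young_diagram_Sigma: "young_diagram l = Sigma {..<length l} (\<lambda>r. {..<l ! r})"
  unfolding young_diagram_def by auto

lemma card_young_diagram: "finite (young_diagram l) \<and> card (young_diagram l) = sum_list l"
  unfolding young_diagram_Sigma by (simp add: sum_list_sum_nth atLeast0LessThan)

lemma young_diagram_bij: "bij_betw young_diagram (partitions n) (ideals n)"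
proof (rule bij_betw_imageI)
  show "inj_on young_diagram (partitions n)"
  proof (rule inj_onI)
    fix l l' assume l: "l \<in> partitions n" "l' \<in> partitions n" "young_diagram l = young_diagram l'"
    have mem: "r < length l \<and> c < l ! r \<longleftrightarrow> r < length l' \<and> c < l' ! r" for r c
    proof -
      have "(r, c) \<in> young_diagram l \<longleftrightarrow> (r, c) \<in> young_diagram l'" using l(3) by simp
      then show ?thesis unfolding young_diagram_def by simp
    qed
    have pos: "r < length m \<Longrightarrow> 0 < m ! r" if "m \<in> partitions n" for m r
      using that unfolding partitions_def by (metis (mono_tags, lifting) gr0I mem_Collect_eq nth_mem)
    \<comment> \<open>As parts are positive, every row shows up in the diagram through its box in
      column 0; so the length can be recovered.\<close>
    have "r < length l \<longleftrightarrow> r < length l'" for r using mem[of r 0] pos l by blast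
    then have "length l = length l'" by (metis linorder_neqE_nat less_irrefl)
    moreover have "l ! r = l' ! r" if "r < length l" for r
      using mem[of r "l ! r"] mem[of r "l' ! r"] that calculation by (metis linorder_neqE_nat less_irrefl)
    ultimately show "l = l'" by (intro nth_equalityI) auto
  qed
  show "young_diagram ` partitions n = ideals n"
  proof (intro subset_antisym subsetI)
    fix D assume "D \<in> young_diagram ` partitions n"
    then obtain l where l: "l \<in> partitions n" "D = young_diagram l" by blast
    have "order_ideal D" unfolding order_ideal_def
    proof (intro allI impI)
      fix r c r' c' assume a: "(r, c) \<in> D" "r' \<le> r" "c' \<le> c"
      then have "r < length l" "c < l ! r" using l(2) unfolding young_diagram_def by auto
      moreover from this have "l ! r \<le> l ! r'"
        using l(1) a(2) sorted_wrt_nth_less[of "(\<ge>)" l r' r] unfolding partitions_def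
        by (cases "r' = r") auto
      ultimately show "(r', c') \<in> D" using a l(2) unfolding young_diagram_def by auto
    qed
    then show "D \<in> ideals n"
      using l card_young_diagram[of l] unfolding ideals_def partitions_def by auto
  next
    fix D assume "D \<in> ideals n"
    then have D: "finite D" "order_ideal D" "card D = n" unfolding ideals_def by auto
    obtain len where row: "\<And>r c. (r, c) \<in> D \<longleftrightarrow> c < len r"
      and anti: "\<And>r r'. r \<le> r' \<Longrightarrow> len r' \<le> len r"
      using order_ideal_rows[OF D(1,2)] by blast
    have "{r. 0 < len r} \<subseteq> fst ` D" using row by force
    then have "finite {r. 0 < len r}" using D(1) finite_subset by blast
    then obtain m where m: "{r. 0 < len r} = {..<m}"
      by (rule finite_down_closed_nat) (use anti in \<open>auto intro: less_le_trans\<close>)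
    \<comment> \<open>Cutting at the first empty row keeps 0 out of the list.\<close>
    define l where "l = map len [0..<m]"
    have yl: "young_diagram l = D"
    proof (rule Set.set_eqI)
      fix b :: "nat \<times> nat"
      obtain r c where b: "b = (r, c)" by (cases b)
      have "0 < len r \<longleftrightarrow> r < m" using m by blast
      then show "b \<in> young_diagram l \<longleftrightarrow> b \<in> D"
        unfolding young_diagram_def l_def b by (auto simp: row)
    qed
    have "sorted_wrt (\<ge>) l" unfolding l_def sorted_wrt_map
      by (rule sorted_wrt_mono_rel[OF _ sorted_wrt_upt]) (use anti in auto)
    moreover have "0 \<notin> set l"
    proof
      assume "0 \<in> set l"
      then obtain r where "r \<in> {..<m}" "len r = 0" unfolding l_def by auto
      then show False unfolding m[symmetric] by simp
    qed
    ultimately have "l \<in> partitions n"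
      using card_young_diagram[of l] yl D unfolding partitions_def by simp
    then show "D \<in> young_diagram ` partitions n" using yl by blast
  qed
qed

text \<open>Reading off the boxes in the order of their entries, \<open>W\<close>, is the bijection.
  It is injective because a tableau is extensional, hence determined by its values on the
  diagram.\<close>

lemma tableaux_count_eq:
  assumes "l \<in> partitions n"
  shows "tableaux_count l = growth_count (young_diagram l)"
proof -
  define D where "D = young_diagram l"
  have D: "finite D" "order_ideal D" "card D = n" and suml: "sum_list l = n"
    using bij_betwE[OF young_diagram_bij] assms unfolding D_def ideals_def partitions_def by auto
  define W where "W T = map (inv_into D T) [1..<Suc n]" for T :: "nat \<times> nat \<Rightarrow> nat"
  have bijT: "bij_betw T D {1..n}" if "T \<in> standard_tableaux l" for T
    using that suml unfolding standard_tableaux_def D_def by auto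
  have lenW: "length (W T) = n" for T unfolding W_def by simp
  have nthW: "W T ! i = inv_into D T (Suc i)" if "i < n" for T i
    using that unfolding W_def by (simp add: nth_map_upt del: upt_Suc)
  have TW: "T (W T ! i) = Suc i" if "T \<in> standard_tableaux l" "i < n" for T i
    unfolding nthW[OF that(2)] using bij_betw_inv_into_right[OF bijT[OF that(1)]] that(2) by simp
  have takeW: "set (take k (W T)) = {b \<in> D. T b \<le> k}" if T: "T \<in> standard_tableaux l" and k: "k \<le> n" for T k
  proof -
    have "set (take k (W T)) = inv_into D T ` {1..<Suc k}"
      unfolding W_def take_map using k by (simp add: take_upt del: upt_Suc)
    also have "\<dots> = {b \<in> D. T b \<le> k}"
    proof (rule Set.set_eqI, rule iffI)
      fix b assume "b \<in> inv_into D T ` {1..<Suc k}"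
      then obtain i where i: "i \<in> {1..<Suc k}" "b = inv_into D T i" by blast
      then have "i \<in> T ` D" using bijT[OF T] k unfolding bij_betw_def by auto
      then show "b \<in> {b \<in> D. T b \<le> k}" using i by (auto simp: f_inv_into_f inv_into_into)
    next
      fix b assume b: "b \<in> {b \<in> D. T b \<le> k}"
      then have "T b \<in> {1..n}" using bijT[OF T] unfolding bij_betw_def by auto
      moreover have "b = inv_into D T (T b)" using bij_betw_inv_into_left[OF bijT[OF T]] b by simp
      ultimately show "b \<in> inv_into D T ` {1..<Suc k}" using b by (intro image_eqI[of _ _ "T b"]) auto
    qed
    finally show ?thesis .
  qed
  have mono: "T (r', c') \<le> T (r, c)"
    if T: "T \<in> standard_tableaux l" and b: "(r, c) \<in> D" "r' \<le> r" "c' \<le> c" for T r c r' c'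
  proof -
    have mem: "(r', c) \<in> D" "(r', c') \<in> D" using order_idealD[OF D(2)] b by auto
    have row: "T (r, c) < T (r, c')" if "(r, c) \<in> D" "(r, c') \<in> D" "c < c'" for r c c'
      using T that unfolding standard_tableaux_def D_def by blast
    have column: "T (r, c) < T (r', c)" if "(r, c) \<in> D" "(r', c) \<in> D" "r < r'" for r r' c
      using T that unfolding standard_tableaux_def D_def by blast
    have "T (r', c') \<le> T (r', c)" using row[OF mem(2,1)] b by (cases "c' = c") auto
    also have "\<dots> \<le> T (r, c)" using column[OF mem(1) b(1)] b by (cases "r' = r") auto
    finally show ?thesis .
  qed
  have "bij_betw W (standard_tableaux l) {xs. growth xs \<and> set xs = D}"
  proof (rule bij_betw_imageI)
    show "inj_on W (standard_tableaux l)"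
    proof (rule inj_onI)
      fix T T' assume T: "T \<in> standard_tableaux l" "T' \<in> standard_tableaux l" "W T = W T'"
      have "T b = T' b" if "b \<in> D" for b
      proof -
        have "b \<in> set (take n (W T))" using takeW[OF T(1)] bijT[OF T(1)] that unfolding bij_betw_def by auto
        then obtain i where "i < n" "b = W T ! i" using lenW by (auto simp: in_set_conv_nth)
        then show ?thesis using TW T by metis
      qed
      moreover have "T \<in> extensional D" "T' \<in> extensional D"
        using T unfolding standard_tableaux_def D_def by auto
      ultimately show "T = T'" by (intro extensionalityI)
    qed
    show "W ` standard_tableaux l = {xs. growth xs \<and> set xs = D}"
    proof (intro subset_antisym subsetI)
      fix xs assume "xs \<in> W ` standard_tableaux l"
      then obtain T where T: "T \<in> standard_tableaux l" "xs = W T" by blast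
      have "distinct (W T)"
        unfolding distinct_conv_nth lenW using TW[OF T(1)] by (metis Suc_inject)
      moreover have "order_ideal (set (take k (W T)))" if "k \<le> n" for k
        unfolding takeW[OF T(1) that] order_ideal_def
        by (auto intro: order_trans[OF mono[OF T(1)]] order_idealD[OF D(2)])
      ultimately have "growth (W T)" unfolding growth_iff_prefixes lenW by blast
      moreover have "set (W T) = D"
        using takeW[OF T(1) order_refl] bijT[OF T(1)] lenW unfolding bij_betw_def by auto
      ultimately show "xs \<in> {xs. growth xs \<and> set xs = D}" using T(2) by simp
    next
      fix xs assume "xs \<in> {xs. growth xs \<and> set xs = D}"
      then have xs: "growth xs" "set xs = D" by auto
      have len: "length xs = n" using length_growth[OF xs(1)] xs(2) D(3) by simp
      have bij: "bij_betw ((!) xs) {..<n} D"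
        using bij_betw_nth[OF growth_distinct[OF xs(1)] refl refl] len xs(2) by simp
      \<comment> \<open>The inverse of \<open>W\<close>: the entry of a box is its list position
        plus 1. The restriction gives the default value outside the diagram that
        \<open>extensional\<close> demands.\<close>
      define T where "T = restrict (\<lambda>b. Suc (inv_into {..<n} ((!) xs) b)) D"
      have Tnth: "T (xs ! i) = Suc i" if "i < n" for i
        unfolding T_def using bij_betw_inv_into_left[OF bij] that len xs(2) by (auto simp: bij_betwE[OF bij])
      have bijT': "bij_betw T D {1..n}"
      proof (rule bij_betw_byWitness[where f' = "\<lambda>i. xs ! (i - 1)"])
        show "\<forall>b\<in>D. xs ! (T b - 1) = b"
          unfolding T_def using bij_betw_inv_into_right[OF bij] by simp
        show "\<forall>i\<in>{1..n}. T (xs ! (i - 1)) = i" using Tnth by auto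
        show "T ` D \<subseteq> {1..n}"
          using bij_betwE[OF bij_betw_inv_into[OF bij]] unfolding T_def by (auto simp: Suc_le_eq)
        show "(\<lambda>i. xs ! (i - 1)) ` {1..n} \<subseteq> D" using bij_betwE[OF bij] by auto
      qed
      have mono': "T (r', c') < T (r, c)"
        if "(r, c) \<in> D" "r' \<le> r" "c' \<le> c" "(r', c') \<noteq> (r, c)" for r c r' c'
      proof -
        have "(r, c) \<in> set xs" using that(1) xs(2) by simp
        then obtain i where i: "i < n" "(r, c) = xs ! i" unfolding in_set_conv_nth len by metis
        have "(r, c) \<in> set (take (Suc i) xs)" using i len by (auto simp: take_Suc_conv_app_nth)
        moreover have "order_ideal (set (take (Suc i) xs))"
          using xs(1) i len unfolding growth_iff_prefixes by auto
        ultimately have "(r', c') \<in> set (take (Suc i) xs)" using that(2,3) order_idealD by blast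
        then obtain j where j: "j < Suc i" "(r', c') = xs ! j" using i len by (auto simp: in_set_conv_nth)
        then have "j < i" using that(4) i(2) by (cases "j = i") auto
        then show ?thesis using Tnth[of i] Tnth[of j] i j by simp
      qed
      have "T \<in> standard_tableaux l"
        unfolding standard_tableaux_def D_def[symmetric] suml
      proof (intro CollectI conjI allI impI)
        show "T \<in> extensional D" unfolding T_def by simp
        show "T (r, c) < T (r, c')" if "(r, c') \<in> D" "c < c'" for r c c'
          using mono'[of r c' r c] that by simp
        show "T (r, c) < T (r', c)" if "(r', c) \<in> D" "r < r'" for r r' c
          using mono'[of r' c r c] that by simp
      qed (rule bijT')
      moreover from this have "W T = xs"
      proof -
        have "inv_into D T (Suc i) = xs ! i" if "i < n" for i
          using bij_betw_inv_into_left[OF bijT', of "xs ! i"] Tnth[OF that] bij_betwE[OF bij] that by simp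
        then show ?thesis using len lenW nthW by (intro nth_equalityI) auto
      qed
      ultimately show "xs \<in> W ` standard_tableaux l" by blast
    qed
  qed
  then show ?thesis
    unfolding tableaux_count_def growth_count_def D_def by (rule bij_betw_same_card)
qed

text \<open>The numbering by rows matters only as an enumeration of the boxes: numerators and
  denominators are multiplied separately, and the denominators give the rising factorial.\<close>

lemma beta_eq:
  assumes "l \<in> partitions n"
  shows "\<beta> n \<theta> l = ideal_eigenvalue n \<theta> (young_diagram l)"
proof -
  have set: "set (boxes_by_row l) = young_diagram l"
    unfolding boxes_by_row_def young_diagram_def by auto
  have "length (boxes_by_row l) = sum_list (map (\<lambda>r. l ! r) [0..<length l])"
    unfolding boxes_by_row_def by (simp add: length_concat o_def)
  then have len: "length (boxes_by_row l) = n" using assms unfolding partitions_def by (simp add: map_nth)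
  then have dist: "distinct (boxes_by_row l)"
    using card_young_diagram[of l] set assms unfolding partitions_def by (intro card_distinct) auto
  have "\<beta> n \<theta> l = (\<Prod>i=1..n. \<theta> + word_content (boxes_by_row l) i) / (\<Prod>i=1..n. \<theta> + real i - 1)"
    unfolding \<beta>_def box_content_def word_content_def by (rule prod_dividef)
  also have "(\<Prod>i=1..n. \<theta> + word_content (boxes_by_row l) i) =
      (\<Prod>b\<in>young_diagram l. \<theta> + real_of_int (content_of b))"
    using prod_word_content[OF dist, of \<theta>] len set by simp
  also have "(\<Prod>i=1..n. \<theta> + real i - 1) = pochhammer \<theta> n"
    unfolding pochhammer_prod
    by (rule prod.reindex_bij_witness[of _ Suc "\<lambda>i. i - 1"]) auto
  finally show ?thesis unfolding ideal_eigenvalue_def .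
qed

text \<open>Passing to complex entries makes the statement cover all eigenvalues, so that non-real
  ones are excluded. Multiplicity is algebraic, the order of the root of the characteristic
  polynomial, and the set of eigenvalues is then read off from the multiplicities.\<close>

theorem mainTheorem2:
  fixes n :: nat and \<theta> :: real and e :: "nat \<Rightarrow> nat \<Rightarrow> nat"
  assumes "n \<ge> 1" and "\<theta> > 1"
    and "bij_betw e {..<fact n} {\<sigma>. \<sigma> permutes {1..n}}"
  defines "P \<equiv> map_mat complex_of_real (transition_matrix n \<theta> e)"
  shows "{x. eigenvalue P x} = (\<lambda>l. complex_of_real (\<beta> n \<theta> l)) ` partitions n \<and>
    (\<forall>x. order x (char_poly P) =
      (\<Sum>l \<in> {l \<in> partitions n. complex_of_real (\<beta> n \<theta> l) = x}. (tableaux_count l)\<^sup>2))"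
proof -
  obtain h :: "nat \<Rightarrow> _" where h: "bij_betw h {..<fact n} (growth_pairs n)"
    using ex_bij_betw_nat_finite[OF finite_growth_pairs[of n]]
    unfolding card_growth_pairs atLeast0LessThan by blast
  define d where "d j = complex_of_real (ideal_eigenvalue n \<theta> (set (fst (h j))))" for j
  have tm: "transition_matrix n \<theta> e \<in> carrier_mat (fact n) (fact n)"
    unfolding transition_matrix_def by simp
  then have P: "P \<in> carrier_mat (fact n) (fact n)" unfolding P_def by simp
  have cp: "char_poly P = (\<Prod>j\<leftarrow>[0..<fact n]. [:- d j, 1:])"
    unfolding P_def of_real_hom.char_poly_hom[OF tm] char_poly_transition_matrix[OF assms(3) h] d_def
    by (rule map_poly_prod_linear)
  have order: "order x (char_poly P) =
      (\<Sum>l \<in> {l \<in> partitions n. complex_of_real (\<beta> n \<theta> l) = x}. (tableaux_count l)\<^sup>2)" for x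
  proof -
    define Q where "Q D \<longleftrightarrow> complex_of_real (ideal_eigenvalue n \<theta> D) = x" for D
    have "order x (char_poly P) = card {j. j < fact n \<and> Q (set (fst (h j)))}"
      unfolding cp order_prod_linear Q_def d_def length_filter_conv_card
      by (intro arg_cong[where f = card]) auto
    also have "\<dots> = card {p \<in> growth_pairs n. Q (set (fst p))}"
    proof (rule bij_betw_same_card)
      have "h ` {j \<in> {..<fact n}. Q (set (fst (h j)))} = {p \<in> h ` {..<fact n}. Q (set (fst p))}" by blast
      then show "bij_betw h {j. j < fact n \<and> Q (set (fst (h j)))} {p \<in> growth_pairs n. Q (set (fst p))}"
        using h by (intro bij_betw_subset[OF h]) (auto simp: bij_betw_def)
    qed
    also have "\<dots> = (\<Sum>D | D \<in> ideals n \<and> Q D. (growth_count D)\<^sup>2)" by (rule card_growth_pairs_filter)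
    also have "\<dots> = (\<Sum>l | l \<in> partitions n \<and> complex_of_real (\<beta> n \<theta> l) = x. (growth_count (young_diagram l))\<^sup>2)"
    proof (rule sum.reindex_bij_betw[symmetric])
      have "Q (young_diagram l) \<longleftrightarrow> complex_of_real (\<beta> n \<theta> l) = x" if "l \<in> partitions n" for l
        unfolding Q_def beta_eq[OF that] ..
      then have "{D \<in> ideals n. Q D} = young_diagram ` {l \<in> partitions n. complex_of_real (\<beta> n \<theta> l) = x}"
        unfolding bij_betw_imp_surj_on[OF young_diagram_bij, symmetric] by blast
      then show "bij_betw young_diagram {l \<in> partitions n. complex_of_real (\<beta> n \<theta> l) = x} {D \<in> ideals n. Q D}"
        by (intro bij_betw_subset[OF young_diagram_bij]) auto
    qed
    also have "\<dots> = (\<Sum>l | l \<in> partitions n \<and> complex_of_real (\<beta> n \<theta> l) = x. (tableaux_count l)\<^sup>2)"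
      using tableaux_count_eq by (intro sum.cong) auto
    finally show ?thesis .
  qed
  \<comment> \<open>Needed to turn roots into positive orders, since every point is a root of the
    zero polynomial.\<close>
  have "char_poly P \<noteq> 0" unfolding cp by (auto simp: prod_list_zero_iff)
  have fin: "finite (partitions n)"
    using bij_betw_finite[OF young_diagram_bij[of n]] finite_ideals by blast
  \<comment> \<open>Every shape has a standard tableau, so each of the listed values really occurs
    as an eigenvalue.\<close>
  have pos: "tableaux_count l > 0" if "l \<in> partitions n" for l
    using tableaux_count_eq[OF that] bij_betwE[OF young_diagram_bij] that growth_count_pos
    unfolding ideals_def by auto
  have "eigenvalue P x \<longleftrightarrow> x \<in> (\<lambda>l. complex_of_real (\<beta> n \<theta> l)) ` partitions n" for x
  proof -
    have "eigenvalue P x \<longleftrightarrow> order x (char_poly P) \<noteq> 0"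
      unfolding eigenvalue_root_char_poly[OF P] order_root using \<open>char_poly P \<noteq> 0\<close> by simp
    also have "\<dots> \<longleftrightarrow> x \<in> (\<lambda>l. complex_of_real (\<beta> n \<theta> l)) ` partitions n"
      unfolding order using fin pos by (auto simp: sum_eq_0_iff)
    finally show ?thesis .
  qed
  then show ?thesis using order by blast
qed

end
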